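(* Let $(X,\mathcal B,\mu,f,T_f)$ be a dissipative composition dynamical system of bounded distortion, generated by $W$, with $T_f:L^p(X)\to L^p(X)$, $1\le p<\infty$, invertible. Assume that $\sup_{n\in\mathbb N}\mu(f^{-n}(W))=\infty$. Then $T_f$ is strongly structurally stable if and only if it has the shadowing property.
   Context: All Banach spaces are complex; $\mathbb N$ is the set of positive integers. A composition dynamical system is a quintuple $(X,\mathcal B,\mu,f,T_f)$ where: $(X,\mathcal B,\mu)$ is a $\sigma$-finite measure space; $f:X\to X$ is an injective bimeasurable transformation, i.e. $f(B)\in\mathcal B$ and $f^{-1}(B)\in\mathcal B$ for every $B\in\mathcal B$; there is $c>0$ such that $\mu(f^{-1}(B))\le c\,\mu(B)$ for every $B\in\mathcal B$; and $T_f:L^p(X)\to L^p(X)$, $1\le p<\infty$, is the composition operator $T_f\varphi=\varphi\circ f$ (a bounded linear operator). It is dissipative, of bounded distortion, generated by $W$ if: $f$ is invertible (bijective) and non-singular (for each $B\in\mathcal B$, $\mu(f^{-1}(B))=0$ iff $\mu(B)=0$); $W\in\mathcal B$ with $0<\mu(W)<\infty$ and $X=\bigcup_{k\in\mathbb Z}f^k(W)$ is a pairwise disjoint union; and there exists $K>0$ such that $$\frac1K\mu(f^k(W))\mu(B)\le\mu(f^k(B))\mu(W)\le K\mu(f^k(W))\mu(B)$$ for all $k\in\mathbb Z$ and all $B\in\mathcal B(W)=\{B\cap W:B\in\mathcal B\}$. Invertibility of $T_f$: $f$ is bijective and there is $c'>0$ such that $\mu(f(B))\le c'\mu(B)$ for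 every $B\in\mathcal B$; then $T_f^{-1}=T_{f^{-1}}$ is bounded. Let $T$ be an invertible bounded linear operator on a Banach space $E$. - $T$ has the shadowing property if for each $\epsilon>0$ there exists $\delta>0$ such that for every sequence $\{x_n\}_{n\in\mathbb Z}$ in $E$ with $\|Tx_n-x_{n+1}\|\le\delta$ for all $n\in\mathbb Z$ there exists $x\in E$ with $\|T^nx-x_n\|<\epsilon$ for all $n\in\mathbb Z$. - $T$ is strongly structurally stable if for every $\gamma>0$ there exists $\epsilon>0$ such that for any bounded Lipschitz map $\phi:E\to E$ with $\|\phi\|_\infty\le\epsilon$ and $\mathrm{Lip}(\phi)\le\epsilon$ there is a homeomorphism $h:E\to E$ with $h\circ T=(T+\phi)\circ h$ and $\|h-I\|_\infty\le\gamma$. *)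

theory Defs
  imports "HOL-Analysis.Analysis"
begin

section \<open>Invertible operators on normed spaces given by an explicit carrier\<close>

text \<open>
  The Lebesgue space of a measure \<open>M\<close> depends on the term \<open>M\<close> and is therefore not a type;
  normed spaces are represented here by records with an explicit carrier.
\<close>

record 'v nspace =
  points :: "'v set"
  vadd   :: "'v \<Rightarrow> 'v \<Rightarrow> 'v"
  vscale :: "complex \<Rightarrow> 'v \<Rightarrow> 'v"
  vnorm  :: "'v \<Rightarrow> real"

text \<open>
  The value \<open>0\<close> outside the carrier is due to \<^locale>\<open>Metric_space\<close>, which requires a
  distance to be nonnegative and symmetric on the whole type.
\<close>

definition vdist :: "'v nspace \<Rightarrow> 'v \<Rightarrow> 'v \<Rightarrow> real" where
  "vdist E x y =
     (if x \<in> points E \<and> y \<in> points E then vnorm E (vadd E x (vscale E (- 1) y)) else 0)"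

definition vtopology :: "'v nspace \<Rightarrow> 'v topology" where
  "vtopology E = Metric_space.mtopology (points E) (vdist E)"

text \<open>Integer iterates of a bijection of \<open>S\<close> onto itself.\<close>

definition ziter :: "'v set \<Rightarrow> ('v \<Rightarrow> 'v) \<Rightarrow> int \<Rightarrow> 'v \<Rightarrow> 'v" where
  "ziter S T n = (if n \<ge> 0 then T ^^ nat n else inv_into S T ^^ nat (- n))"

definition shadowing_property :: "'v nspace \<Rightarrow> ('v \<Rightarrow> 'v) \<Rightarrow> bool" where
  "shadowing_property E T \<longleftrightarrow>
     (\<forall>\<epsilon>>0. \<exists>\<delta>>0. \<forall>x :: int \<Rightarrow> 'v.
        (\<forall>n. x n \<in> points E) \<and> (\<forall>n. vdist E (T (x n)) (x (n + 1)) \<le> \<delta>) \<longrightarrow>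
        (\<exists>y \<in> points E. \<forall>n. vdist E (ziter (points E) T n y) (x n) < \<epsilon>))"

text \<open>
  The bound on \<open>vnorm E (\<phi> x)\<close> already makes \<open>\<phi>\<close> bounded, and the
  bound \<open>\<epsilon>\<close> on the Lipschitz constant makes it Lipschitz.
\<close>

definition strongly_structurally_stable :: "'v nspace \<Rightarrow> ('v \<Rightarrow> 'v) \<Rightarrow> bool" where
  "strongly_structurally_stable E T \<longleftrightarrow>
     (\<forall>\<gamma>>0. \<exists>\<epsilon>>0. \<forall>\<phi>.
        \<phi> \<in> points E \<rightarrow> points E \<and>
        (\<forall>x \<in> points E. vnorm E (\<phi> x) \<le> \<epsilon>) \<and>
        (\<forall>x \<in> points E. \<forall>y \<in> points E. vdist E (\<phi> x) (\<phi> y) \<le> \<epsilon> * vdist E x y) \<longrightarrow>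
        (\<exists>h. homeomorphic_map (vtopology E) (vtopology E) h \<and>
             (\<forall>x \<in> points E. h (T x) = vadd E (T (h x)) (\<phi> (h x))) \<and>
             (\<forall>x \<in> points E. vdist E (h x) x \<le> \<gamma>)))"


section \<open>Complex Lebesgue spaces and composition operators\<close>

definition Lp_funs :: "real \<Rightarrow> 'a measure \<Rightarrow> ('a \<Rightarrow> complex) set" where
  "Lp_funs p M = {g \<in> borel_measurable M. integrable M (\<lambda>x. norm (g x) powr p)}"

definition Lp_rel :: "real \<Rightarrow> 'a measure \<Rightarrow> (('a \<Rightarrow> complex) \<times> ('a \<Rightarrow> complex)) set" where
  "Lp_rel p M = {(g, h). g \<in> Lp_funs p M \<and> h \<in> Lp_funs p M \<and> (AE x in M. g x = h x)}"

definition Lp_class :: "real \<Rightarrow> 'a measure \<Rightarrow> ('a \<Rightarrow> complex) \<Rightarrow> ('a \<Rightarrow> complex) set" where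
  "Lp_class p M g = Lp_rel p M `` {g}"

definition Lp :: "real \<Rightarrow> 'a measure \<Rightarrow> ('a \<Rightarrow> complex) set nspace" where
  "Lp p M =
     \<lparr> points = Lp_funs p M // Lp_rel p M,
       vadd   = (\<lambda>F G. \<Union>g\<in>F. \<Union>h\<in>G. Lp_class p M (\<lambda>x. g x + h x)),
       vscale = (\<lambda>c F. \<Union>g\<in>F. Lp_class p M (\<lambda>x. c * g x)),
       vnorm  = (\<lambda>F. the_elem ((\<lambda>g. (\<integral>x. norm (g x) powr p \<partial>M) powr (1 / p)) ` F)) \<rparr>"

definition comp_op ::
  "real \<Rightarrow> 'a measure \<Rightarrow> ('a \<Rightarrow> 'a) \<Rightarrow> ('a \<Rightarrow> complex) set \<Rightarrow> ('a \<Rightarrow> complex) set" where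
  "comp_op p M f F = (\<Union>g\<in>F. Lp_class p M (g \<circ> f))"


section \<open>Composition dynamical systems\<close>

locale composition_system = sigma_finite_measure M
  for M :: "'a measure" and f :: "'a \<Rightarrow> 'a" and p :: real +
  assumes p_ge_1: "1 \<le> p"
    and maps_to: "f \<in> space M \<rightarrow> space M"
    and injective: "inj_on f (space M)"
    and image_measurable: "B \<in> sets M \<Longrightarrow> f ` B \<in> sets M"
    and preimage_measurable: "B \<in> sets M \<Longrightarrow> f -` B \<inter> space M \<in> sets M"
    and preimage_bound:
      "\<exists>c>0. \<forall>B\<in>sets M. emeasure M (f -` B \<inter> space M) \<le> ennreal c * emeasure M B"

locale dissipative_bounded_distortion_system = composition_system M f p
  for M :: "'a measure" and f :: "'a \<Rightarrow> 'a" and p :: real +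
  fixes W :: "'a set"
  assumes bijective: "bij_betw f (space M) (space M)"
    and non_singular:
      "B \<in> sets M \<Longrightarrow> emeasure M (f -` B \<inter> space M) = 0 \<longleftrightarrow> emeasure M B = 0"
    and W_measurable: "W \<in> sets M"
    and W_pos: "0 < emeasure M W"
    and W_finite: "emeasure M W < \<infinity>"
    and W_disjoint: "disjoint_family (\<lambda>k::int. ziter (space M) f k ` W)"
    and W_generates: "space M = (\<Union>k::int. ziter (space M) f k ` W)"
    and bounded_distortion:
      "\<exists>K>0. \<forall>k::int. \<forall>B \<in> {A \<inter> W |A. A \<in> sets M}.
         ennreal (1 / K) * (emeasure M (ziter (space M) f k ` W) * emeasure M B)
           \<le> emeasure M (ziter (space M) f k ` B) * emeasure M W \<and>
         emeasure M (ziter (space M) f k ` B) * emeasure M W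
           \<le> ennreal K * (emeasure M (ziter (space M) f k ` W) * emeasure M B)"

definition invertible_composition :: "'a measure \<Rightarrow> ('a \<Rightarrow> 'a) \<Rightarrow> bool" where
  "invertible_composition M f \<longleftrightarrow>
     bij_betw f (space M) (space M) \<and>
     (\<exists>c>0. \<forall>B\<in>sets M. emeasure M (f ` B) \<le> ennreal c * emeasure M B)"

end

theory Submission
  imports Defs
begin

text \<open>
  Write \<open>a k = \<mu>(f^k W)\<close> and \<open>T = T_f\<close>. Both properties turn out to be equivalent to \<open>T\<close> being
  expanding, that is, some power of \<open>T\<inverse>\<close> being a contraction.

  Structural stability for a constant perturbation \<open>z\<close>, or shadowing of the pseudo-orbit
  \<open>x\<^sub>n = z + T z + \<dots> + T^(n-1) z\<close>, yields \<open>g\<close> in \<open>L^p\<close> with \<open>\<parallel>T^n g - x\<^sub>n\<parallel> \<le> 1\<close> for all \<open>n \<ge> 0\<close>. Take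
  for \<open>z\<close> a multiple \<open>s\<close> of the indicator of \<open>f^k W\<close>. Since the numbers \<open>a (- i)\<close> are unbounded,
  restricting this bound to \<open>f^(-i) W\<close> and using bounded distortion forces \<open>g = s\<close> on \<open>f^l W\<close> for
  every \<open>l > k\<close>. Hence \<open>a (k+1) + a (k+2) + \<dots> \<le> D * a k\<close> with \<open>D\<close> independent of \<open>k\<close>, and therefore
  \<open>n * a (k+n) \<le> D\<^sup>2 * a k\<close>: high powers of \<open>T\<inverse>\<close> are contractions.

  Conversely, if \<open>T\<close> is expanding then so is \<open>T + \<phi>\<close> for small Lipschitz \<open>\<phi>\<close>, as one sees in the
  adapted distance \<open>\<Sum>j<N. \<parallel>T^(-j) (x - y)\<parallel>\<close>. An expanding bijection of a complete metric space has a
  unique orbit near each forward pseudo-orbit, namely the limit of the pullbacks of its terms. This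
  gives shadowing, and applied to the orbits of \<open>T\<close> and \<open>T + \<phi>\<close> it gives the conjugacy.
\<close>

section \<open>Expanding bijections of complete metric spaces\<close>

text \<open>Pulling the term at time \<open>m + n\<close> back to time \<open>m\<close> gives a
  sequence in \<open>n\<close> that is Cauchy, because an error made at time \<open>m + n\<close>
  shrinks like \<open>q ^ n\<close> on the way back. The limits for the various \<open>m\<close>
  form the orbit, and the geometric series gives its distance from \<open>x m\<close>.\<close>

lemma (in Metric_space) forward_shadowing:
  assumes complete: "mcomplete" and bij: "bij_betw A M M" and q: "0 \<le> q" "q < 1" and C: "0 \<le> C"
    and expanding: "\<And>x y n. x \<in> M \<Longrightarrow> y \<in> M \<Longrightarrow> d x y \<le> C * q ^ n * d ((A ^^ n) x) ((A ^^ n) y)"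
    and x: "\<And>n. x n \<in> M" and step: "\<And>n. d (A (x n)) (x (Suc n)) \<le> \<eta>"
  shows "\<exists>y. \<forall>n. y n \<in> M \<and> A (y n) = y (Suc n) \<and> d (y n) (x n) \<le> C * \<eta> / (1 - q)"
proof -
  define B where "B = inv_into M A"
  have AM: "A z \<in> M" if "z \<in> M" for z
    using bij that by (auto simp: bij_betw_def)
  have BM: "B z \<in> M" if "z \<in> M" for z
    using bij that unfolding B_def by (metis bij_betw_def inv_into_into)
  have AB: "A (B z) = z" if "z \<in> M" for z
    using bij that unfolding B_def by (metis bij_betw_inv_into_right)
  have BA: "B (A z) = z" if "z \<in> M" for z
    using bij that unfolding B_def by (metis bij_betw_inv_into_left)
  have AnM: "(A ^^ n) z \<in> M" if "z \<in> M" for z n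
    using that by (induction n) (auto intro: AM)
  have BnM: "(B ^^ n) z \<in> M" if "z \<in> M" for z n
    using that by (induction n) (auto intro: BM)
  have AnBn: "(A ^^ n) ((B ^^ n) z) = z" if "z \<in> M" for z n
    using that
  proof (induction n arbitrary: z)
    case (Suc n)
    have "(A ^^ Suc n) ((B ^^ Suc n) z) = A ((A ^^ n) ((B ^^ n) (B z)))"
      by (simp add: funpow_swap1)
    then show ?case
      using Suc by (simp add: BM AB)
  qed auto
  have \<eta>: "0 \<le> \<eta>"
    using step[of 0] nonneg order_trans by blast
  define u where "u m n = (B ^^ n) (x (m + n))" for m n
  have uM: "u m n \<in> M" for m n
    by (simp add: u_def BnM x)
  have u_step: "d (u m n) (u m (Suc n)) \<le> C * \<eta> * q ^ n" for m n
  proof -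
    \<comment> \<open>After \<open>Suc n\<close> steps the two consecutive approximants land on the
      two sides of a single jump of the pseudo-orbit.\<close>
    have "(A ^^ Suc n) (u m n) = A (x (m + n))"
      by (simp add: u_def AnBn x)
    moreover have "(A ^^ Suc n) (u m (Suc n)) = x (Suc (m + n))"
      unfolding u_def by (subst AnBn) (auto simp: x)
    ultimately have "d (u m n) (u m (Suc n)) \<le> C * q ^ Suc n * d (A (x (m + n))) (x (Suc (m + n)))"
      using expanding[OF uM uM, of m n m "Suc n" "Suc n"] by simp
    also have "\<dots> \<le> C * q ^ Suc n * \<eta>"
      using step C q by (intro mult_left_mono) auto
    also have "\<dots> \<le> C * q ^ n * \<eta>"
      using C q \<eta> by (intro mult_right_mono mult_left_mono) (auto simp: mult_left_le_one_le)
    finally show ?thesis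
      by (simp add: mult_ac)
  qed
  have u_far: "d (u m n) (u m (n + k)) \<le> C * \<eta> * q ^ n / (1 - q)" for m n k
  proof -
    \<comment> \<open>The exact partial sum of the geometric series is kept so that the induction on
      \<open>k\<close> closes.\<close>
    have "d (u m n) (u m (n + k)) \<le> C * \<eta> * q ^ n * (1 - q ^ k) / (1 - q)"
    proof (induction k)
      case 0
      then show ?case using uM by simp
    next
      case (Suc k)
      have "d (u m n) (u m (n + Suc k)) \<le> d (u m n) (u m (n + k)) + d (u m (n + k)) (u m (Suc (n + k)))"
        using triangle uM by simp
      also have "\<dots> \<le> C * \<eta> * q ^ n * (1 - q ^ k) / (1 - q) + C * \<eta> * q ^ (n + k)"
        using Suc u_step by (intro add_mono)
      also have "\<dots> = C * \<eta> * q ^ n * (1 - q ^ Suc k) / (1 - q)"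
        using q by (simp add: field_simps power_add)
      finally show ?case .
    qed
    also have "\<dots> \<le> C * \<eta> * q ^ n / (1 - q)"
      using C \<eta> q by (intro divide_right_mono) (auto simp: mult_left_le)
    finally show ?thesis .
  qed
  have "\<exists>y. limitin mtopology (u m) y sequentially" for m
  proof -
    have "MCauchy (u m)"
      unfolding MCauchy_def
    proof (intro conjI allI impI)
      fix e :: real assume "0 < e"
      have "(\<lambda>n. C * \<eta> * q ^ n / (1 - q)) \<longlonglongrightarrow> C * \<eta> * 0 / (1 - q)"
        using q by (intro tendsto_intros LIMSEQ_realpow_zero) auto
      then have "\<forall>\<^sub>F n in sequentially. C * \<eta> * q ^ n / (1 - q) < e / 2"
        using \<open>0 < e\<close> by (intro order_tendstoD) auto
      then obtain N where N: "C * \<eta> * q ^ N / (1 - q) < e / 2"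
        by (auto simp: eventually_sequentially)
      show "\<exists>N. \<forall>n n'. N \<le> n \<longrightarrow> N \<le> n' \<longrightarrow> d (u m n) (u m n') < e"
      proof (intro exI[of _ N] allI impI)
        fix n n' assume "N \<le> n" "N \<le> n'"
        then obtain k k' where "n = N + k" "n' = N + k'"
          by (meson le_iff_add)
        then show "d (u m n) (u m n') < e"
          using u_far[of m N k] u_far[of m N k'] N triangle''[OF uM uM uM, of m n m n' m N]
          by (smt (verit) field_sum_of_halves commute)
      qed
    qed (use uM in auto)
    then show ?thesis
      using complete by (simp add: mcomplete_def)
  qed
  then obtain y where y: "\<And>m. limitin mtopology (u m) (y m) sequentially"
    by metis
  have yM: "y m \<in> M" for m
    using y by (simp add: limitin_metric)
  have close: "d (y m) (x m) \<le> C * \<eta> / (1 - q)" for m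
  proof (rule field_le_epsilon)
    fix e :: real assume "0 < e"
    then obtain n where n: "d (u m n) (y m) < e"
      using y[of m] unfolding limitin_metric eventually_sequentially by blast
    have "d (y m) (x m) \<le> d (y m) (u m n) + d (u m n) (u m 0)"
      using triangle[of "y m" "u m n" "u m 0"] yM uM x by (simp add: u_def)
    then show "d (y m) (x m) \<le> C * \<eta> / (1 - q) + e"
      using n u_far[of m 0 n] commute[of "y m"] commute[of "u m 0"] by auto
  qed
  \<comment> \<open>Since \<open>u m (Suc n) = B (u (Suc m) n)\<close> and \<open>B\<close> is
    Lipschitz, the limits satisfy \<open>y m = B (y (Suc m))\<close>. The divisor
    \<open>C + 1\<close> used below stays positive when \<open>C = 0\<close>.\<close>
  have "limitin mtopology (\<lambda>n. u m (Suc n)) (B (y (Suc m))) sequentially" for m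
    unfolding limitin_metric
  proof (intro conjI allI impI)
    fix e :: real assume e: "0 < e"
    have lip: "d (B z) (B w) \<le> C * d z w" if "z \<in> M" "w \<in> M" for z w
    proof -
      have "d (B z) (B w) \<le> C * q * d z w"
        using expanding[of "B z" "B w" 1] that by (simp add: BM AB)
      also have "\<dots> \<le> C * 1 * d z w"
        using C q by (intro mult_right_mono mult_left_mono) auto
      finally show ?thesis by simp
    qed
    have "\<forall>\<^sub>F n in sequentially. u (Suc m) n \<in> M \<and> d (u (Suc m) n) (y (Suc m)) < e / (C + 1)"
      using y[of "Suc m"] e C unfolding limitin_metric by auto
    then show "\<forall>\<^sub>F n in sequentially. u m (Suc n) \<in> M \<and> d (u m (Suc n)) (B (y (Suc m))) < e"
    proof eventually_elim
      case (elim n)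
      have "u m (Suc n) = B (u (Suc m) n)"
        by (simp add: u_def)
      then have "d (u m (Suc n)) (B (y (Suc m))) \<le> C * d (u (Suc m) n) (y (Suc m))"
        using lip[OF uM yM] by simp
      also have "\<dots> \<le> (C + 1) * d (u (Suc m) n) (y (Suc m))"
        by (intro mult_right_mono) auto
      also have "\<dots> < e"
        using elim C by (simp add: field_simps)
      finally show ?case
        using uM by simp
    qed
  qed (simp add: BM yM)
  moreover have "limitin mtopology (\<lambda>n. u m (Suc n)) (y m) sequentially" for m
    using limitin_sequentially_offset[OF y[of m], of 1] by simp
  ultimately have "y m = B (y (Suc m))" for m
    using limitin_metric_unique trivial_limit_sequentially by metis
  then have "A (y m) = y (Suc m)" for m
    using AB yM by metis
  then show ?thesis
    using yM close by auto
qed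

text \<open>Expansion turns a bound \<open>R\<close> at time \<open>n\<close> into
  \<open>C * q ^ n * R\<close> at time \<open>0\<close>, which tends to zero. This is the source of
  every identity between orbits below.\<close>

lemma (in Metric_space) expanding_unique:
  assumes q: "0 \<le> q" "q < 1" and C: "0 \<le> C"
    and expanding: "\<And>x y n. x \<in> M \<Longrightarrow> y \<in> M \<Longrightarrow> d x y \<le> C * q ^ n * d ((A ^^ n) x) ((A ^^ n) y)"
    and xy: "x \<in> M" "y \<in> M" and bound: "\<And>n. d ((A ^^ n) x) ((A ^^ n) y) \<le> R"
  shows "x = y"
proof -
  have "(\<lambda>n. C * q ^ n * R) \<longlonglongrightarrow> C * 0 * R"
    using q by (intro tendsto_intros LIMSEQ_realpow_zero) auto
  moreover have "d x y \<le> C * q ^ n * R" for n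
    using expanding[OF xy, of n] bound[of n] C q
    by (meson mult_left_mono mult_nonneg_nonneg order_trans zero_le_power)
  ultimately have "d x y \<le> 0"
    by (intro LIMSEQ_le_const[of _ "0"]) auto
  then show ?thesis
    using xy by (metis nonneg order_antisym zero)
qed

text \<open>The conjugacy sends a point to the unique \<open>A\<close>-orbit that shadows its \<open>B\<close>-orbit.\<close>

lemma (in Metric_space) expanding_conjugacy:
  assumes complete: "mcomplete" and bijA: "bij_betw A M M" and bijB: "bij_betw B M M"
    and q: "0 \<le> q" "q < 1" and C: "0 \<le> C"
    and expA: "\<And>x y n. x \<in> M \<Longrightarrow> y \<in> M \<Longrightarrow> d x y \<le> C * q ^ n * d ((A ^^ n) x) ((A ^^ n) y)"
    and expB: "\<And>x y n. x \<in> M \<Longrightarrow> y \<in> M \<Longrightarrow> d x y \<le> C * q ^ n * d ((B ^^ n) x) ((B ^^ n) y)"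
    and L: "0 \<le> L"
    and lipA: "\<And>x y. x \<in> M \<Longrightarrow> y \<in> M \<Longrightarrow> d (A x) (A y) \<le> L * d x y"
    and lipB: "\<And>x y. x \<in> M \<Longrightarrow> y \<in> M \<Longrightarrow> d (B x) (B y) \<le> L * d x y"
    and near: "\<And>x. x \<in> M \<Longrightarrow> d (A x) (B x) \<le> \<eta>"
  shows "\<exists>h. homeomorphic_map mtopology mtopology h \<and> (\<forall>x\<in>M. h (B x) = A (h x)) \<and>
             (\<forall>x\<in>M. d (h x) x \<le> C * \<eta> / (1 - q))"
proof -
  define R where "R = C * \<eta> / (1 - q)"
  have iterM: "(G ^^ n) z \<in> M" if "bij_betw G M M" "z \<in> M" for G z n
    using that by (induction n) (auto simp: bij_betw_def)
  have ex: "\<exists>y\<in>M. \<forall>n. d ((G ^^ n) y) ((H ^^ n) x) \<le> R"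
    if G: "bij_betw G M M" and H: "bij_betw H M M"
      and expG: "\<And>x y n. x \<in> M \<Longrightarrow> y \<in> M \<Longrightarrow> d x y \<le> C * q ^ n * d ((G ^^ n) x) ((G ^^ n) y)"
      and GH: "\<And>x. x \<in> M \<Longrightarrow> d (G x) (H x) \<le> \<eta>" and x: "x \<in> M" for G H x
  proof -
    obtain y where y: "\<And>n. y n \<in> M \<and> G (y n) = y (Suc n) \<and> d (y n) ((H ^^ n) x) \<le> R"
      using forward_shadowing[OF complete G q C expG, of "\<lambda>n. (H ^^ n) x" \<eta>] GH iterM[OF H x]
      unfolding R_def by auto
    have "(G ^^ n) (y 0) = y n" for n
      by (induction n) (auto simp: y)
    then show ?thesis
      using y by metis
  qed
  obtain h where h: "\<And>x. x \<in> M \<Longrightarrow> h x \<in> M \<and> (\<forall>n. d ((A ^^ n) (h x)) ((B ^^ n) x) \<le> R)"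
    using ex[OF bijA bijB expA near] by metis
  obtain k where k: "\<And>x. x \<in> M \<Longrightarrow> k x \<in> M \<and> (\<forall>n. d ((B ^^ n) (k x)) ((A ^^ n) x) \<le> R)"
    using ex[OF bijB bijA expB] near commute by metis
  \<comment> \<open>Both points have \<open>H\<close>-orbits within \<open>R\<close> of the
    \<open>G\<close>-orbit of \<open>h' x\<close>, so uniqueness identifies them. Stated for general
    \<open>G\<close> and \<open>H\<close> to serve both compositions.\<close>
  have inverse: "k' (h' x) = x"
    if G: "bij_betw G M M" and H: "bij_betw H M M" and x: "x \<in> M"
      and expH: "\<And>x y n. x \<in> M \<Longrightarrow> y \<in> M \<Longrightarrow> d x y \<le> C * q ^ n * d ((H ^^ n) x) ((H ^^ n) y)"
      and h': "\<And>x. x \<in> M \<Longrightarrow> h' x \<in> M \<and> (\<forall>n. d ((G ^^ n) (h' x)) ((H ^^ n) x) \<le> R)"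
      and k': "\<And>x. x \<in> M \<Longrightarrow> k' x \<in> M \<and> (\<forall>n. d ((H ^^ n) (k' x)) ((G ^^ n) x) \<le> R)"
    for G H h' k' x
  proof (rule expanding_unique[OF q C expH])
    show "k' (h' x) \<in> M" "x \<in> M"
      using h' k' x by auto
    show "d ((H ^^ n) (k' (h' x))) ((H ^^ n) x) \<le> 2 * R" for n
      using triangle[of "(H ^^ n) (k' (h' x))" "(G ^^ n) (h' x)" "(H ^^ n) x"]
        h'[OF x] k'[of "h' x"] iterM[OF H] iterM[OF G] x
      by (smt (verit))
  qed
  have continuous: "continuous_map mtopology mtopology h'"
    if expG: "\<And>x y n. x \<in> M \<Longrightarrow> y \<in> M \<Longrightarrow> d x y \<le> C * q ^ n * d ((G ^^ n) x) ((G ^^ n) y)"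
      and G: "bij_betw G M M" and H: "bij_betw H M M"
      and lipH: "\<And>x y. x \<in> M \<Longrightarrow> y \<in> M \<Longrightarrow> d (H x) (H y) \<le> L * d x y"
      and h': "\<And>x. x \<in> M \<Longrightarrow> h' x \<in> M \<and> (\<forall>n. d ((G ^^ n) (h' x)) ((H ^^ n) x) \<le> R)" for G H h'
    unfolding metric_continuous_map[OF Metric_space_axioms]
  proof (intro conjI ballI allI impI)
    fix a and e :: real assume a: "a \<in> M" and e: "0 < e"
    have R: "0 \<le> R"
      using h'[OF a] nonneg order_trans by blast
    have lipHn: "d ((H ^^ n) x) ((H ^^ n) y) \<le> L ^ n * d x y" if "x \<in> M" "y \<in> M" for x y n
    proof (induction n)
      case (Suc n)
      have "d ((H ^^ Suc n) x) ((H ^^ Suc n) y) \<le> L * d ((H ^^ n) x) ((H ^^ n) y)"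
        using lipH iterM[OF H] that by simp
      also have "\<dots> \<le> L * (L ^ n * d x y)"
        using Suc L by (rule mult_left_mono)
      finally show ?case by (simp add: mult_ac)
    qed auto
    \<comment> \<open>The time \<open>n\<close> is chosen so late that a gap of
      \<open>2 * R + 1\<close> then means a gap below \<open>e\<close> at time \<open>0\<close>.
      Starting points close enough to be at most \<open>1\<close> apart after \<open>n\<close> steps
      of \<open>H\<close> have shadowing orbits with such a gap.\<close>
    have "(\<lambda>n. C * q ^ n * (2 * R + 1)) \<longlonglongrightarrow> C * 0 * (2 * R + 1)"
      using q by (intro tendsto_intros LIMSEQ_realpow_zero) auto
    then have "\<forall>\<^sub>F n in sequentially. C * q ^ n * (2 * R + 1) < e"
      using e by (intro order_tendstoD) auto
    then obtain n where n: "C * q ^ n * (2 * R + 1) < e"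
      by (auto simp: eventually_sequentially)
    show "\<exists>\<delta>>0. \<forall>x. x \<in> M \<and> d a x < \<delta> \<longrightarrow> d (h' a) (h' x) < e"
    proof (intro exI[of _ "1 / (L ^ n + 1)"] conjI allI impI)
      show "0 < 1 / (L ^ n + 1)"
        using L by (simp add: add_nonneg_pos)
      fix x assume x: "x \<in> M \<and> d a x < 1 / (L ^ n + 1)"
      have "L ^ n * d a x \<le> (L ^ n + 1) * d a x"
        by (intro mult_right_mono) auto
      also have "\<dots> \<le> 1"
        using x pos_less_divide_eq[of "L ^ n + 1" "d a x" 1] L
        by (simp add: mult.commute add_nonneg_pos)
      finally have "d ((H ^^ n) a) ((H ^^ n) x) \<le> 1"
        using lipHn[OF a, of x n] x by simp
      then have "d ((G ^^ n) (h' a)) ((G ^^ n) (h' x)) \<le> 2 * R + 1"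
        using h'[OF a] h'[of x] x
          triangle[of "(G ^^ n) (h' a)" "(H ^^ n) a" "(G ^^ n) (h' x)"]
          triangle[of "(H ^^ n) a" "(H ^^ n) x" "(G ^^ n) (h' x)"]
          iterM[OF H, of a n] iterM[OF H, of x n] iterM[OF G, of "h' x" n] iterM[OF G, of "h' a" n] a
          commute[of "(G ^^ n) (h' x)" "(H ^^ n) x"]
        by (smt (verit))
      then have "d (h' a) (h' x) \<le> C * q ^ n * (2 * R + 1)"
        using expG[of "h' a" "h' x" n] h'[OF a] h'[of x] x C q
        by (meson mult_left_mono mult_nonneg_nonneg order_trans zero_le_power)
      then show "d (h' a) (h' x) < e"
        using n by simp
    qed
  qed (use h' in auto)
  have "homeomorphic_maps mtopology mtopology h k"
    unfolding homeomorphic_maps_def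
    using continuous[OF expA bijA bijB lipB h] continuous[OF expB bijB bijA lipA k]
      inverse[OF bijA bijB _ expB h k] inverse[OF bijB bijA _ expA k h] by simp
  \<comment> \<open>The \<open>A\<close>-orbits of both sides stay within \<open>R\<close> of the
    \<open>B\<close>-orbit of \<open>B x\<close>.\<close>
  moreover have "h (B x) = A (h x)" if x: "x \<in> M" for x
  proof (rule expanding_unique[OF q C expA])
    have Bx: "B x \<in> M" and Ahx: "A (h x) \<in> M"
      using iterM[OF bijB x, of 1] iterM[OF bijA, of "h x" 1] h[OF x] by auto
    then show "h (B x) \<in> M" "A (h x) \<in> M"
      using h by auto
    show "d ((A ^^ n) (h (B x))) ((A ^^ n) (A (h x))) \<le> 2 * R" for n
    proof -
      have "d ((A ^^ n) (h (B x))) ((B ^^ n) (B x)) \<le> R"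
        using h Bx by blast
      moreover have "d ((A ^^ n) (A (h x))) ((B ^^ n) (B x)) \<le> R"
        using h[OF x] by (metis funpow_Suc_right comp_apply)
      ultimately show ?thesis
        using triangle''[of "(A ^^ n) (h (B x))" "(A ^^ n) (A (h x))" "(B ^^ n) (B x)"]
          iterM[OF bijA] iterM[OF bijB] Bx Ahx h[OF Bx] commute
        by (smt (verit) triangle)
    qed
  qed
  moreover have "d (h x) x \<le> R" if "x \<in> M" for x
    using h[OF that] by (metis funpow_0)
  ultimately show ?thesis
    unfolding R_def by (metis homeomorphic_maps_imp_map)
qed

section \<open>Expanding operators\<close>

text \<open>Collects the laws of addition, subtraction and distance used by the perturbation
  argument, so that this argument runs without reference to measures or equivalence classes.\<close>

locale complete_nspace =
  fixes E :: "'v nspace"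
  assumes metric: "Metric_space (points E) (vdist E)"
    and complete: "Metric_space.mcomplete (points E) (vdist E)"
    and vadd_closed: "x \<in> points E \<Longrightarrow> y \<in> points E \<Longrightarrow> vadd E x y \<in> points E"
    and vadd_commute: "x \<in> points E \<Longrightarrow> y \<in> points E \<Longrightarrow> vadd E x y = vadd E y x"
    and vdist_vadd_right:
      "x \<in> points E \<Longrightarrow> y \<in> points E \<Longrightarrow> z \<in> points E \<Longrightarrow>
        vdist E (vadd E x z) (vadd E y z) = vdist E x y"
    and vdist_vadd_self: "x \<in> points E \<Longrightarrow> z \<in> points E \<Longrightarrow> vdist E (vadd E x z) x = vnorm E z"
    and vsub_closed: "x \<in> points E \<Longrightarrow> z \<in> points E \<Longrightarrow> vadd E x (vscale E (- 1) z) \<in> points E"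
    and vsub_vadd:
      "x \<in> points E \<Longrightarrow> z \<in> points E \<Longrightarrow> vadd E (vadd E x (vscale E (- 1) z)) z = x"
begin

sublocale Metric_space "points E" "vdist E"
  by (rule metric)

lemma vdist_vadd_left:
  assumes "x \<in> points E" "y \<in> points E" "z \<in> points E"
  shows "vdist E (vadd E z x) (vadd E z y) = vdist E x y"
  using assms vadd_commute vdist_vadd_right by metis

text \<open>With \<open>u = z - x\<close> and \<open>v = z - y\<close>, translation by
  \<open>x\<close> turns \<open>u\<close> into \<open>z = v + y\<close> and \<open>v\<close> into
  \<open>v + x\<close>, so translation invariance on both sides suffices.\<close>

lemma vdist_vsub_left:
  assumes "x \<in> points E" "y \<in> points E" "z \<in> points E"
  shows "vdist E (vadd E z (vscale E (- 1) x)) (vadd E z (vscale E (- 1) y)) = vdist E x y"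
proof -
  let ?u = "vadd E z (vscale E (- 1) x)" and ?v = "vadd E z (vscale E (- 1) y)"
  have "vdist E ?u ?v = vdist E (vadd E ?u x) (vadd E ?v x)"
    using assms by (simp add: vdist_vadd_right vsub_closed)
  also have "\<dots> = vdist E (vadd E ?v y) (vadd E ?v x)"
    using assms by (simp add: vsub_vadd)
  also have "\<dots> = vdist E x y"
    using assms by (simp add: vdist_vadd_left vsub_closed commute)
  finally show ?thesis .
qed

end

text \<open>Expansion is encoded by one power of the inverse that halves distances; the powers below
  \<open>N\<close> are controlled by \<open>c\<close>.\<close>

locale expanding_operator = complete_nspace +
  fixes T :: "'a \<Rightarrow> 'a" and L c :: real and N :: nat
  assumes bij: "bij_betw T (points E) (points E)"
    and additive: "x \<in> points E \<Longrightarrow> y \<in> points E \<Longrightarrow> T (vadd E x y) = vadd E (T x) (T y)"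
    and L: "0 \<le> L" and c: "0 \<le> c" and N: "0 < N"
    and T_lipschitz: "x \<in> points E \<Longrightarrow> y \<in> points E \<Longrightarrow> vdist E (T x) (T y) \<le> L * vdist E x y"
    and inv_lipschitz:
      "x \<in> points E \<Longrightarrow> y \<in> points E \<Longrightarrow>
        vdist E (inv_into (points E) T x) (inv_into (points E) T y) \<le> c * vdist E x y"
    and inv_iterate_contraction:
      "x \<in> points E \<Longrightarrow> y \<in> points E \<Longrightarrow>
        vdist E ((inv_into (points E) T ^^ N) x) ((inv_into (points E) T ^^ N) y) \<le> vdist E x y / 2"
begin

section \<open>The adapted distance\<close>

abbreviation "U \<equiv> inv_into (points E) T"

lemma T_closed: "x \<in> points E \<Longrightarrow> T x \<in> points E"
  using bij by (auto simp: bij_betw_def)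

lemma U_closed: "x \<in> points E \<Longrightarrow> U x \<in> points E"
  using bij by (metis bij_betw_def inv_into_into)

lemma T_U: "x \<in> points E \<Longrightarrow> T (U x) = x"
  using bij by (metis bij_betw_inv_into_right)

lemma U_T: "x \<in> points E \<Longrightarrow> U (T x) = x"
  using bij by (metis bij_betw_inv_into_left)

lemma U_iter_closed: "x \<in> points E \<Longrightarrow> (U ^^ j) x \<in> points E"
  by (induction j) (auto intro: U_closed)

lemma U_additive:
  assumes "x \<in> points E" "y \<in> points E"
  shows "U (vadd E x y) = vadd E (U x) (U y)"
  using assms by (metis T_U U_T U_closed additive vadd_closed)

lemma U_iter_additive:
  assumes "x \<in> points E" "y \<in> points E"
  shows "(U ^^ j) (vadd E x y) = vadd E ((U ^^ j) x) ((U ^^ j) y)"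
  using assms by (induction j) (auto simp: U_additive U_iter_closed)

text \<open>
  A distance equivalent to \<open>vdist\<close> that the inverse of \<open>T\<close> contracts in a single step.
\<close>

definition adapted :: "'a \<Rightarrow> 'a \<Rightarrow> real" where
  "adapted x y = (\<Sum>j<N. vdist E ((U ^^ j) x) ((U ^^ j) y))"

text \<open>The constant comparing \<open>adapted\<close> with \<open>vdist\<close>; it is a
  different quantity from the distortion bound of a dissipative system.\<close>

definition distortion :: real where
  "distortion = (\<Sum>j<N. c ^ j)"

lemma distortion_ge_1: "1 \<le> distortion"
proof -
  have "(\<Sum>j\<in>{0}. c ^ j) \<le> distortion"
    unfolding distortion_def using N c by (intro sum_mono2) auto
  then show ?thesis by simp
qed

lemma vdist_le_adapted: "vdist E x y \<le> adapted x y"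
proof -
  have "(\<Sum>j\<in>{0}. vdist E ((U ^^ j) x) ((U ^^ j) y)) \<le> adapted x y"
    unfolding adapted_def using N by (intro sum_mono2) auto
  then show ?thesis by simp
qed

lemma adapted_nonneg: "0 \<le> adapted x y"
  unfolding adapted_def by (intro sum_nonneg) auto

lemma adapted_le:
  assumes "x \<in> points E" "y \<in> points E"
  shows "adapted x y \<le> distortion * vdist E x y"
proof -
  have "vdist E ((U ^^ j) x) ((U ^^ j) y) \<le> c ^ j * vdist E x y" for j
  proof (induction j)
    case (Suc j)
    have "vdist E ((U ^^ Suc j) x) ((U ^^ Suc j) y) \<le> c * vdist E ((U ^^ j) x) ((U ^^ j) y)"
      using assms by (simp add: inv_lipschitz U_iter_closed)
    also have "\<dots> \<le> c * (c ^ j * vdist E x y)"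
      using Suc c by (rule mult_left_mono)
    finally show ?case by (simp add: mult_ac)
  qed auto
  then show ?thesis
    unfolding adapted_def distortion_def sum_distrib_right by (rule sum_mono)
qed

lemma adapted_triangle:
  assumes "x \<in> points E" "y \<in> points E" "z \<in> points E"
  shows "adapted x z \<le> adapted x y + adapted y z"
  unfolding adapted_def sum.distrib[symmetric]
  using assms by (intro sum_mono triangle U_iter_closed)

lemma adapted_vadd_right:
  assumes "x \<in> points E" "y \<in> points E" "z \<in> points E"
  shows "adapted (vadd E x z) (vadd E y z) = adapted x y"
  using assms by (simp add: adapted_def U_iter_additive vdist_vadd_right U_iter_closed)

lemma adapted_vadd_left:
  assumes "x \<in> points E" "y \<in> points E" "z \<in> points E"
  shows "adapted (vadd E z x) (vadd E z y) = adapted x y"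
  using assms vadd_commute adapted_vadd_right by metis

text \<open>Applying \<open>U\<close> shifts the sum by one index: the term \<open>j = 0\<close> is
  lost and the term \<open>j = N\<close>, at most half of it, is gained. The net loss
  \<open>vdist E x y / 2\<close> is a fixed fraction of \<open>adapted x y\<close> by
  \<open>adapted_le\<close>.\<close>

lemma adapted_U:
  assumes "x \<in> points E" "y \<in> points E"
  shows "adapted (U x) (U y) \<le> (1 - 1 / (2 * distortion)) * adapted x y"
proof -
  let ?e = "\<lambda>j. vdist E ((U ^^ j) x) ((U ^^ j) y)"
  have "adapted (U x) (U y) = (\<Sum>j<N. ?e (Suc j))"
    by (simp add: adapted_def funpow_swap1)
  also have "\<dots> = adapted x y + ?e N - ?e 0"
    using sum.lessThan_Suc[of ?e N] sum.lessThan_Suc_shift[of ?e N] unfolding adapted_def by linarith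
  also have "\<dots> \<le> adapted x y - vdist E x y / 2"
    using inv_iterate_contraction[OF assms] by simp
  also have "\<dots> \<le> (1 - 1 / (2 * distortion)) * adapted x y"
    using adapted_le[OF assms] distortion_ge_1 by (simp add: field_simps)
  finally show ?thesis .
qed

lemma adapted_T:
  assumes "x \<in> points E" "y \<in> points E"
  shows "adapted x y \<le> (1 - 1 / (2 * distortion)) * adapted (T x) (T y)"
  using adapted_U[of "T x" "T y"] assms by (simp add: T_closed U_T)

section \<open>Stability of expansion under small Lipschitz perturbations\<close>

text \<open>The midpoint of \<open>1\<close> and the rate of \<open>adapted_T\<close>; the slack is
  spent on the perturbation.\<close>

abbreviation "rate \<equiv> 1 - 1 / (4 * distortion)"

lemma rate: "0 \<le> rate" "rate < 1"
  using distortion_ge_1 by (auto simp: field_simps)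

text \<open>The perturbation changes the adapted distance of the images by at most a small multiple
  of \<open>adapted x y\<close>, which is absorbed on the left-hand side.\<close>

lemma adapted_perturbed:
  assumes \<phi>: "\<phi> \<in> points E \<rightarrow> points E"
    and lip: "\<And>x y. x \<in> points E \<Longrightarrow> y \<in> points E \<Longrightarrow> vdist E (\<phi> x) (\<phi> y) \<le> \<epsilon> * vdist E x y"
    and \<epsilon>: "\<epsilon> \<le> 1 / (4 * distortion\<^sup>2)" and x: "x \<in> points E" and y: "y \<in> points E"
  shows "adapted x y \<le> rate * adapted (vadd E (T x) (\<phi> x)) (vadd E (T y) (\<phi> y))"
proof -
  \<comment> \<open>The gain of \<open>T\<close> in one step, so that \<open>rate\<close> is
    \<open>1 - \<kappa> / 2\<close>. In the bound on \<open>\<epsilon>\<close>, one factor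
    \<open>distortion\<close> pays for measuring \<open>\<phi>\<close> in the adapted distance, and
    the remaining \<open>1 / (4 * distortion)\<close> is \<open>\<kappa> / 2\<close>.\<close>
  define \<kappa> where "\<kappa> = 1 / (2 * distortion)"
  have \<kappa>: "0 < \<kappa>" "\<kappa> \<le> 1 / 2"
    using distortion_ge_1 by (auto simp: \<kappa>_def field_simps)
  let ?Sx = "vadd E (T x) (\<phi> x)" and ?Sy = "vadd E (T y) (\<phi> y)"
  have pts: "\<phi> x \<in> points E" "\<phi> y \<in> points E" "T x \<in> points E" "T y \<in> points E"
    using \<phi> x y T_closed by auto
  have "adapted (\<phi> x) (\<phi> y) \<le> distortion * vdist E (\<phi> x) (\<phi> y)"
    using pts adapted_le by blast
  also have "\<dots> \<le> distortion * (1 / (4 * distortion\<^sup>2) * vdist E x y)"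
    using lip[OF x y] mult_right_mono[OF \<epsilon>, of "vdist E x y"] distortion_ge_1
    by (intro mult_left_mono) auto
  also have "\<dots> = \<kappa> / 2 * vdist E x y"
    using distortion_ge_1 by (simp add: \<kappa>_def field_simps power2_eq_square)
  also have "\<dots> \<le> \<kappa> / 2 * adapted x y"
    using \<kappa> vdist_le_adapted by (intro mult_left_mono) auto
  finally have A: "adapted (\<phi> x) (\<phi> y) \<le> \<kappa> / 2 * adapted x y" .
  have "adapted (T x) (T y) = adapted ?Sx (vadd E (T y) (\<phi> x))"
    using pts by (simp add: adapted_vadd_right)
  also have "\<dots> \<le> adapted ?Sx ?Sy + adapted ?Sy (vadd E (T y) (\<phi> x))"
    using pts by (intro adapted_triangle vadd_closed)
  also have "adapted ?Sy (vadd E (T y) (\<phi> x)) = adapted (\<phi> x) (\<phi> y)"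
    using pts by (simp add: adapted_vadd_left) (simp add: adapted_def commute)
  finally have B: "adapted (T x) (T y) \<le> adapted ?Sx ?Sy + \<kappa> / 2 * adapted x y"
    using A by simp
  have "adapted x y \<le> (1 - \<kappa>) * adapted (T x) (T y)"
    using adapted_T[OF x y] by (simp add: \<kappa>_def)
  also have "\<dots> \<le> (1 - \<kappa>) * (adapted ?Sx ?Sy + \<kappa> / 2 * adapted x y)"
    using B \<kappa> by (intro mult_left_mono) auto
  \<comment> \<open>The first summand grows by \<open>1 - \<kappa> <= (1 - \<kappa> / 2)^2\<close>,
    the second by dropping \<open>1 - \<kappa>\<close>. Moving the second one to the left then
    leaves a common factor \<open>1 - \<kappa> / 2\<close> to cancel.\<close>
  also have "\<dots> \<le> (1 - \<kappa> / 2)\<^sup>2 * adapted ?Sx ?Sy + \<kappa> / 2 * adapted x y"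
  proof -
    have "(1 - \<kappa>) * adapted ?Sx ?Sy \<le> (1 - \<kappa> / 2)\<^sup>2 * adapted ?Sx ?Sy"
      using adapted_nonneg by (intro mult_right_mono) (auto simp: power2_eq_square algebra_simps)
    moreover have "(1 - \<kappa>) * (\<kappa> / 2 * adapted x y) \<le> \<kappa> / 2 * adapted x y"
      using \<kappa> adapted_nonneg by (intro mult_left_le_one_le) auto
    ultimately show ?thesis by (simp only: distrib_left add_mono)
  qed
  finally have "(1 - \<kappa> / 2) * adapted x y \<le> (1 - \<kappa> / 2) * ((1 - \<kappa> / 2) * adapted ?Sx ?Sy)"
    by (simp add: field_simps power2_eq_square)
  then show ?thesis
    using \<kappa> by (simp add: \<kappa>_def)
qed

text \<open>Iterating in the adapted distance and returning to \<open>vdist\<close> only at the end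
  costs the factor \<open>distortion\<close> once, whatever \<open>n\<close> is. The result has the
  shape of the expansion hypothesis in the metric lemmas.\<close>

lemma expanding_if_adapted:
  assumes G: "\<And>x. x \<in> points E \<Longrightarrow> G x \<in> points E"
    and exp: "\<And>x y. x \<in> points E \<Longrightarrow> y \<in> points E \<Longrightarrow> adapted x y \<le> rate * adapted (G x) (G y)"
    and x: "x \<in> points E" and y: "y \<in> points E"
  shows "vdist E x y \<le> distortion * rate ^ n * vdist E ((G ^^ n) x) ((G ^^ n) y)"
proof -
  have iter: "(G ^^ n) z \<in> points E" if "z \<in> points E" for n z
    using that by (induction n) (auto intro: G)
  have "adapted x y \<le> rate ^ n * adapted ((G ^^ n) x) ((G ^^ n) y)"
  proof (induction n)
    case (Suc n)
    have "rate ^ n * adapted ((G ^^ n) x) ((G ^^ n) y)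
        \<le> rate ^ n * (rate * adapted ((G ^^ Suc n) x) ((G ^^ Suc n) y))"
      using exp[OF iter[OF x] iter[OF y], of n n] rate by (intro mult_left_mono) auto
    with Suc show ?case by (simp add: mult_ac)
  qed auto
  also have "\<dots> \<le> rate ^ n * (distortion * vdist E ((G ^^ n) x) ((G ^^ n) y))"
    using rate adapted_le iter x y by (intro mult_left_mono) auto
  finally show ?thesis
    using vdist_le_adapted[of x y] by (simp add: mult_ac)
qed

lemma adapted_T_rate:
  assumes x: "x \<in> points E" and y: "y \<in> points E"
  shows "adapted x y \<le> rate * adapted (T x) (T y)"
proof -
  have "1 - 1 / (2 * distortion) \<le> rate"
    using distortion_ge_1 by (simp add: field_simps)
  then show ?thesis
    using adapted_T[OF x y] mult_right_mono[OF _ adapted_nonneg] order_trans by blast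
qed

section \<open>Shadowing and structural stability of expanding operators\<close>

text \<open>Forward shadowing is applied from every starting time \<open>m\<close>. By uniqueness
  the forward orbits found for \<open>m\<close> and \<open>m + 1\<close> agree where both are
  defined, so they glue to one two-sided orbit.\<close>

lemma shadowing: "shadowing_property E T"
  unfolding shadowing_property_def
proof (intro allI impI)
  fix \<epsilon> :: real assume \<epsilon>: "0 < \<epsilon>"
  \<comment> \<open>The factor \<open>2\<close> makes the resulting distance strictly smaller than
    \<open>\<epsilon>\<close>.\<close>
  define \<delta> where "\<delta> = \<epsilon> * (1 - rate) / (2 * distortion)"
  have \<delta>: "0 < \<delta>" "distortion * \<delta> / (1 - rate) < \<epsilon>"
    using \<epsilon> rate distortion_ge_1 by (auto simp: \<delta>_def field_simps)
  note expT = expanding_if_adapted[OF T_closed adapted_T_rate]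
  show "\<exists>\<delta>>0. \<forall>x. (\<forall>n. x n \<in> points E) \<and> (\<forall>n. vdist E (T (x n)) (x (n + 1)) \<le> \<delta>) \<longrightarrow>
      (\<exists>y\<in>points E. \<forall>n. vdist E (ziter (points E) T n y) (x n) < \<epsilon>)"
  proof (rule exI[of _ \<delta>], intro conjI allI impI)
    fix x :: "int \<Rightarrow> 'a"
    assume x: "(\<forall>n. x n \<in> points E) \<and> (\<forall>n. vdist E (T (x n)) (x (n + 1)) \<le> \<delta>)"
    define R where "R = distortion * \<delta> / (1 - rate)"
    have "\<exists>y. \<forall>n. y n \<in> points E \<and> T (y n) = y (Suc n) \<and> vdist E (y n) (x (m + int n)) \<le> R" for m
      unfolding R_def
    proof (rule forward_shadowing[OF complete bij rate _ expT])
      show "vdist E (T (x (m + int n))) (x (m + int (Suc n))) \<le> \<delta>" for n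
        using x by (metis add.assoc add.commute int_ops(4))
    qed (use x distortion_ge_1 in auto)
    then obtain y where y: "\<And>m n. y m n \<in> points E \<and> T (y m n) = y m (Suc n)
        \<and> vdist E (y m n) (x (m + int n)) \<le> R"
      by metis
    have iter: "(T ^^ n) (y m k) = y m (n + k)" for m n k
      by (induction n) (auto simp: y)
    have orbit: "T (y m 0) = y (m + 1) 0" for m
    proof (rule expanding_unique[OF rate _ expT])
      show "vdist E ((T ^^ n) (T (y m 0))) ((T ^^ n) (y (m + 1) 0)) \<le> 2 * R" for n
      proof -
        let ?x = "x (m + int (Suc n))"
        have "(T ^^ n) (T (y m 0)) = y m (Suc n)" "(T ^^ n) (y (m + 1) 0) = y (m + 1) n"
          using iter[of n m "Suc 0"] iter[of n "m + 1" 0] y by simp_all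
        moreover have "vdist E (y m (Suc n)) ?x \<le> R" "vdist E (y (m + 1) n) ?x \<le> R"
          using y[of m "Suc n"] y[of "m + 1" n] by (simp_all add: algebra_simps)
        moreover have "vdist E (y m (Suc n)) (y (m + 1) n)
            \<le> vdist E (y m (Suc n)) ?x + vdist E (y (m + 1) n) ?x"
          using y x by (intro triangle') auto
        ultimately show ?thesis by simp
      qed
    qed (use y distortion_ge_1 in auto)
    have forward: "(T ^^ n) (y 0 0) = y (int n) 0" for n
      by (induction n) (auto simp: orbit add.commute)
    have backward: "(U ^^ n) (y 0 0) = y (- int n) 0" for n
    proof (induction n)
      case (Suc n)
      have "T (y (- int (Suc n)) 0) = y (- int n) 0"
        using orbit[of "- int (Suc n)"] by simp
      then show ?case
        using Suc U_T y by (metis comp_apply funpow.simps(2))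
    qed auto
    have "ziter (points E) T n (y 0 0) = y n 0" for n
      using forward[of "nat n"] backward[of "nat (- n)"] by (auto simp: ziter_def)
    then have "vdist E (ziter (points E) T n (y 0 0)) (x n) < \<epsilon>" for n
      using y[of n 0] \<delta>(2) by (simp add: R_def)
    then show "\<exists>z\<in>points E. \<forall>n. vdist E (ziter (points E) T n z) (x n) < \<epsilon>"
      using y by blast
  qed (rule \<delta>(1))
qed

text \<open>Injectivity follows from expansion in the adapted distance. For surjectivity, a solution
  of \<open>T x + \<phi> x = y\<close> is a fixed point of
  \<open>x \<mapsto> U (y - \<phi> x)\<close>, a contraction with constant
  \<open>c * \<epsilon>\<close>.\<close>

lemma perturbed_bij:
  assumes \<phi>: "\<phi> \<in> points E \<rightarrow> points E"
    and lip: "\<And>x y. x \<in> points E \<Longrightarrow> y \<in> points E \<Longrightarrow> vdist E (\<phi> x) (\<phi> y) \<le> \<epsilon> * vdist E x y"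
    and \<epsilon>: "\<epsilon> \<le> 1 / (4 * distortion\<^sup>2)" "c * \<epsilon> < 1"
  shows "bij_betw (\<lambda>x. vadd E (T x) (\<phi> x)) (points E) (points E)"
  unfolding bij_betw_def
proof
  let ?S = "\<lambda>x. vadd E (T x) (\<phi> x)"
  have SM: "?S x \<in> points E" if "x \<in> points E" for x
    using \<phi> that T_closed vadd_closed by auto
  show "inj_on ?S (points E)"
  proof (rule inj_onI)
    fix x y assume xy: "x \<in> points E" "y \<in> points E" "?S x = ?S y"
    then have "adapted x y \<le> rate * adapted (?S x) (?S x)"
      using adapted_perturbed[OF \<phi> lip \<epsilon>(1), of x y] by simp
    also have "adapted (?S x) (?S x) = 0"
      using SM xy U_iter_closed by (simp add: adapted_def)
    finally show "x = y"
      using vdist_le_adapted[of x y] xy by (metis mult_zero_right nonneg order_antisym order_trans zero)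
  qed
  have "y \<in> ?S ` points E" if y: "y \<in> points E" for y
  proof -
    obtain x where x: "x \<in> points E" "U (vadd E y (vscale E (- 1) (\<phi> x))) = x"
    proof (rule Banach_fixedpoint_thm[OF complete, of "\<lambda>x. U (vadd E y (vscale E (- 1) (\<phi> x)))" "c * \<epsilon>"])
      show "points E \<noteq> {}" using y by blast
      show "(\<lambda>x. U (vadd E y (vscale E (- 1) (\<phi> x)))) \<in> points E \<rightarrow> points E"
        using y \<phi> U_closed vsub_closed by auto
      show "vdist E (U (vadd E y (vscale E (- 1) (\<phi> u)))) (U (vadd E y (vscale E (- 1) (\<phi> v))))
          \<le> c * \<epsilon> * vdist E u v" if uv: "u \<in> points E" "v \<in> points E" for u v
      proof -
        have \<phi>uv: "\<phi> u \<in> points E" "\<phi> v \<in> points E"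
          using \<phi> uv by auto
        have "vdist E (U (vadd E y (vscale E (- 1) (\<phi> u)))) (U (vadd E y (vscale E (- 1) (\<phi> v))))
            \<le> c * vdist E (vadd E y (vscale E (- 1) (\<phi> u))) (vadd E y (vscale E (- 1) (\<phi> v)))"
          using \<phi>uv y by (intro inv_lipschitz vsub_closed)
        also have "\<dots> = c * vdist E (\<phi> u) (\<phi> v)"
          using \<phi>uv y by (simp add: vdist_vsub_left)
        also have "\<dots> \<le> c * (\<epsilon> * vdist E u v)"
          using lip[OF uv] c by (rule mult_left_mono)
        finally show ?thesis by simp
      qed
    qed (use \<epsilon> that in auto)
    have \<phi>x: "\<phi> x \<in> points E"
      using \<phi> x by auto
    have "T x = vadd E y (vscale E (- 1) (\<phi> x))"
      using x(2) T_U[OF vsub_closed[OF y \<phi>x]] by simp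
    then have "?S x = y"
      using vsub_vadd[OF y \<phi>x] by simp
    then show ?thesis
      using x(1) by blast
  qed
  then show "?S ` points E = points E"
    using SM by blast
qed

lemma structurally_stable: "strongly_structurally_stable E T"
  unfolding strongly_structurally_stable_def
proof (intro allI impI)
  fix \<gamma> :: real assume \<gamma>: "0 < \<gamma>"
  \<comment> \<open>The three bounds serve, in this order, the expansion of the perturbed map, the
    contraction constant \<open>c * \<epsilon> < 1\<close>, and the displacement bound
    \<open>\<gamma>\<close>.\<close>
  define \<epsilon> where "\<epsilon> = Min {1 / (4 * distortion\<^sup>2), 1 / (2 * (c + 1)), \<gamma> * (1 - rate) / distortion}"
  have \<epsilon>_pos: "0 < \<epsilon>"
    using \<gamma> c rate distortion_ge_1 by (auto simp: \<epsilon>_def)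
  have \<epsilon>: "\<epsilon> \<le> 1 / (4 * distortion\<^sup>2)" "\<epsilon> \<le> 1 / (2 * (c + 1))" "\<epsilon> \<le> \<gamma> * (1 - rate) / distortion"
    unfolding \<epsilon>_def by (auto intro!: Min_le)
  have "c * \<epsilon> \<le> c * (1 / (2 * (c + 1)))"
    using \<epsilon>(2) c by (rule mult_left_mono)
  also have "\<dots> < 1"
    using c by (simp add: field_simps)
  finally have c\<epsilon>: "c * \<epsilon> < 1" .
  have \<epsilon>\<gamma>: "distortion * \<epsilon> / (1 - rate) \<le> \<gamma>"
    using \<epsilon>(3) rate distortion_ge_1 by (simp add: field_simps)
  note expT = expanding_if_adapted[OF T_closed adapted_T_rate]
  show "\<exists>\<epsilon>>0. \<forall>\<phi>. \<phi> \<in> points E \<rightarrow> points E \<and> (\<forall>x\<in>points E. vnorm E (\<phi> x) \<le> \<epsilon>) \<and>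
      (\<forall>x\<in>points E. \<forall>y\<in>points E. vdist E (\<phi> x) (\<phi> y) \<le> \<epsilon> * vdist E x y) \<longrightarrow>
      (\<exists>h. homeomorphic_map (vtopology E) (vtopology E) h \<and>
        (\<forall>x\<in>points E. h (T x) = vadd E (T (h x)) (\<phi> (h x))) \<and>
        (\<forall>x\<in>points E. vdist E (h x) x \<le> \<gamma>))"
  proof (rule exI[of _ \<epsilon>], intro conjI allI impI)
    fix \<phi>
    assume "\<phi> \<in> points E \<rightarrow> points E \<and> (\<forall>x\<in>points E. vnorm E (\<phi> x) \<le> \<epsilon>) \<and>
      (\<forall>x\<in>points E. \<forall>y\<in>points E. vdist E (\<phi> x) (\<phi> y) \<le> \<epsilon> * vdist E x y)"
    then have \<phi>: "\<phi> \<in> points E \<rightarrow> points E"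
      and small: "\<And>x. x \<in> points E \<Longrightarrow> vnorm E (\<phi> x) \<le> \<epsilon>"
      and lip: "\<And>x y. x \<in> points E \<Longrightarrow> y \<in> points E \<Longrightarrow> vdist E (\<phi> x) (\<phi> y) \<le> \<epsilon> * vdist E x y"
      by auto
    let ?S = "\<lambda>x. vadd E (T x) (\<phi> x)"
    have pts: "\<phi> x \<in> points E" "T x \<in> points E" "?S x \<in> points E" if "x \<in> points E" for x
      using \<phi> that T_closed vadd_closed by auto
    have expS: "vdist E x y \<le> distortion * rate ^ n * vdist E ((?S ^^ n) x) ((?S ^^ n) y)"
      if "x \<in> points E" "y \<in> points E" for x y n
      using expanding_if_adapted[of ?S, OF pts(3) adapted_perturbed[OF \<phi> lip \<epsilon>(1)] that] .
    have lipS: "vdist E (?S x) (?S y) \<le> (L + \<epsilon>) * vdist E x y"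
      if xy: "x \<in> points E" "y \<in> points E" for x y
    proof -
      have "vdist E (?S x) (?S y)
          \<le> vdist E (?S x) (vadd E (T y) (\<phi> x)) + vdist E (vadd E (T y) (\<phi> x)) (?S y)"
        using xy by (intro triangle vadd_closed pts)
      also have "\<dots> = vdist E (T x) (T y) + vdist E (\<phi> x) (\<phi> y)"
        using xy by (simp add: vdist_vadd_right vdist_vadd_left pts)
      finally show ?thesis
        using T_lipschitz[OF xy] lip[OF xy] by (simp add: algebra_simps)
    qed
    have lipT: "vdist E (T x) (T y) \<le> (L + \<epsilon>) * vdist E x y"
      if "x \<in> points E" "y \<in> points E" for x y
      using T_lipschitz[OF that] \<epsilon>_pos nonneg[of x y] by (simp add: algebra_simps add_increasing2)
    have near: "vdist E (?S x) (T x) \<le> \<epsilon>" if "x \<in> points E" for x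
      using small[OF that] pts[OF that] by (simp add: vdist_vadd_self)
    \<comment> \<open>The perturbed map takes the role of \<open>A\<close> and \<open>T\<close> that
      of \<open>B\<close> in \<open>expanding_conjugacy\<close>, which puts \<open>h\<close> on the
      sides required by the definition.\<close>
    have "\<exists>h. homeomorphic_map mtopology mtopology h \<and> (\<forall>x\<in>points E. h (T x) = ?S (h x)) \<and>
        (\<forall>x\<in>points E. vdist E (h x) x \<le> distortion * \<epsilon> / (1 - rate))"
      by (rule expanding_conjugacy[OF complete perturbed_bij[OF \<phi> lip \<epsilon>(1) c\<epsilon>] bij rate _ expS expT _ lipS lipT near])
        (use L \<epsilon>_pos distortion_ge_1 in auto)
    then show "\<exists>h. homeomorphic_map (vtopology E) (vtopology E) h \<and>
        (\<forall>x\<in>points E. h (T x) = ?S (h x)) \<and> (\<forall>x\<in>points E. vdist E (h x) x \<le> \<gamma>)"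
      using \<epsilon>\<gamma> unfolding vtopology_def by (meson order_trans)
  qed (rule \<epsilon>_pos)
qed

end

section \<open>The Banach space of p-integrable functions\<close>

text \<open>Convexity of the \<open>p\<close>-th power at the points \<open>u / t\<close> and
  \<open>v / (1 - t)\<close> with weights \<open>t\<close> and \<open>1 - t\<close>.\<close>

lemma powr_add_convex:
  fixes u v t p :: real
  assumes p: "1 \<le> p" and t: "0 < t" "t < 1" and uv: "0 \<le> u" "0 \<le> v"
  shows "(u + v) powr p \<le> t powr (1 - p) * u powr p + (1 - t) powr (1 - p) * v powr p"
proof -
  have scale: "s * (w / s) powr p = s powr (1 - p) * w powr p" if "0 < s" "0 \<le> w" for s w :: real
    using that by (simp add: powr_divide powr_diff)
  have small: "(s * w) powr p \<le> s * w powr p" if "0 < s" "s \<le> 1" "0 \<le> w" for s w :: real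
  proof -
    have "s powr p \<le> s"
      using that p powr_mono'[of 1 p s] by simp
    then show ?thesis
      using that by (simp add: powr_mult mult_right_mono)
  qed
  have "(u + v) powr p = (t * (u / t) + (1 - t) * (v / (1 - t))) powr p"
    using t by simp
  also have "\<dots> \<le> t * (u / t) powr p + (1 - t) * (v / (1 - t)) powr p"
  \<comment> \<open>If an argument vanishes, a single summand remains and \<open>small\<close>, that
    is \<open>s powr p <= s\<close> for \<open>s\<close> in the unit interval, gives the
    bound.\<close>
  proof (cases "u = 0 \<or> v = 0")
    case True
    then show ?thesis
      using small[of t "u / t"] small[of "1 - t" "v / (1 - t)"] t uv p by auto
  next
    case False
    then show ?thesis
      using convex_onD[OF powr_convex[OF p], of "1 - t" "u / t" "v / (1 - t)"] t uv by simp
  qed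
  also have "\<dots> = t powr (1 - p) * u powr p + (1 - t) powr (1 - p) * v powr p"
    using scale[of t u] scale[of "1 - t" v] t uv by simp
  finally show ?thesis .
qed

locale Lp_space =
  fixes M :: "'a measure" and p :: real
  assumes exponent: "1 \<le> p"
begin

section \<open>Minkowski's inequality\<close>

text \<open>The \<open>p\<close>-th power of the norm with values in \<open>ennreal\<close>, so that
  estimates can precede the proof of integrability.\<close>

definition pmass :: "('a \<Rightarrow> complex) \<Rightarrow> ennreal" where
  "pmass g = (\<integral>\<^sup>+x. ennreal (norm (g x) powr p) \<partial>M)"

definition Lnorm :: "('a \<Rightarrow> complex) \<Rightarrow> real" where
  "Lnorm g = (\<integral>x. norm (g x) powr p \<partial>M) powr (1 / p)"

lemma Lp_funs_iff: "g \<in> Lp_funs p M \<longleftrightarrow> g \<in> borel_measurable M \<and> pmass g < \<infinity>"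
  unfolding Lp_funs_def pmass_def by (auto simp: integrable_iff_bounded)

lemma Lp_funs_measurable: "g \<in> Lp_funs p M \<Longrightarrow> g \<in> borel_measurable M"
  by (simp add: Lp_funs_def)

lemma Lnorm_nonneg: "0 \<le> Lnorm g"
  by (simp add: Lnorm_def)

lemma Lnorm_powr:
  assumes "g \<in> Lp_funs p M"
  shows "ennreal (Lnorm g powr p) = pmass g"
proof -
  have "pmass g = ennreal (\<integral>x. norm (g x) powr p \<partial>M)"
    unfolding pmass_def using assms by (intro nn_integral_eq_integral) (auto simp: Lp_funs_def)
  moreover have "Lnorm g powr p = (\<integral>x. norm (g x) powr p \<partial>M)"
    using exponent by (simp add: Lnorm_def powr_powr)
  ultimately show ?thesis by simp
qed

lemma Lnorm_le_iff:
  assumes "g \<in> Lp_funs p M" "0 \<le> r"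
  shows "Lnorm g \<le> r \<longleftrightarrow> pmass g \<le> ennreal (r powr p)"
proof -
  have "Lnorm g \<le> r \<longleftrightarrow> Lnorm g powr p \<le> r powr p"
    using exponent assms(2) Lnorm_nonneg[of g]
    by (metis less_le_trans linorder_not_less powr_less_mono2 powr_mono2 zero_less_one order_less_imp_le)
  then show ?thesis
    using Lnorm_powr[OF assms(1)] by (metis ennreal_le_iff powr_ge_zero)
qed

lemma pmass_scale: "pmass (\<lambda>x. c * g x) = ennreal (norm c powr p) * pmass g" if "g \<in> borel_measurable M"
  unfolding pmass_def using that
  by (subst nn_integral_cmult[symmetric]) (auto simp: norm_mult powr_mult ennreal_mult intro!: nn_integral_cong)

lemma Lp_funs_scale: "g \<in> Lp_funs p M \<Longrightarrow> (\<lambda>x. c * g x) \<in> Lp_funs p M"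
  by (auto simp: Lp_funs_iff pmass_scale ennreal_mult_less_top)

text \<open>The weight \<open>t\<close> is left free: \<open>t = 1/2\<close> yields closure under
  addition, and a weight fitted to the two norms yields the triangle inequality.\<close>

lemma pmass_add_le:
  assumes g: "g \<in> Lp_funs p M" and h: "h \<in> Lp_funs p M" and t: "0 < t" "t < 1"
  shows "pmass (\<lambda>x. g x + h x) \<le> ennreal (t powr (1 - p)) * pmass g + ennreal ((1 - t) powr (1 - p)) * pmass h"
proof -
  have [measurable]: "g \<in> borel_measurable M" "h \<in> borel_measurable M"
    using g h by (auto simp: Lp_funs_measurable)
  have "pmass (\<lambda>x. g x + h x) \<le> (\<integral>\<^sup>+x. ennreal (t powr (1 - p)) * ennreal (norm (g x) powr p)
      + ennreal ((1 - t) powr (1 - p)) * ennreal (norm (h x) powr p) \<partial>M)"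
    unfolding pmass_def
  proof (intro nn_integral_mono)
    fix x
    have "norm (g x + h x) powr p \<le> (norm (g x) + norm (h x)) powr p"
      using exponent by (intro powr_mono2 norm_triangle_ineq) auto
    also have "\<dots> \<le> t powr (1 - p) * norm (g x) powr p + (1 - t) powr (1 - p) * norm (h x) powr p"
      using powr_add_convex[OF exponent t] by simp
    finally show "ennreal (norm (g x + h x) powr p)
        \<le> ennreal (t powr (1 - p)) * ennreal (norm (g x) powr p)
          + ennreal ((1 - t) powr (1 - p)) * ennreal (norm (h x) powr p)"
      by (simp add: ennreal_leI flip: ennreal_mult ennreal_plus)
  qed
  also have "\<dots> = ennreal (t powr (1 - p)) * pmass g + ennreal ((1 - t) powr (1 - p)) * pmass h"
    unfolding pmass_def by (simp add: nn_integral_add nn_integral_cmult)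
  finally show ?thesis .
qed

lemma Lp_funs_add:
  assumes "g \<in> Lp_funs p M" "h \<in> Lp_funs p M"
  shows "(\<lambda>x. g x + h x) \<in> Lp_funs p M"
proof -
  have "pmass (\<lambda>x. g x + h x) \<le> ennreal ((1/2) powr (1 - p)) * pmass g + ennreal ((1 - 1/2) powr (1 - p)) * pmass h"
    using assms by (intro pmass_add_le) auto
  also have "\<dots> < \<infinity>"
    using assms by (auto simp: Lp_funs_iff ennreal_mult_less_top)
  finally show ?thesis
    using assms by (auto simp: Lp_funs_iff)
qed

lemma Lp_funs_diff:
  assumes "g \<in> Lp_funs p M" "h \<in> Lp_funs p M"
  shows "(\<lambda>x. g x - h x) \<in> Lp_funs p M"
  using Lp_funs_add[OF assms(1) Lp_funs_scale[OF assms(2), of "- 1"]] by simp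

lemma Lnorm_minus: "Lnorm (\<lambda>x. g x - h x) = Lnorm (\<lambda>x. h x - g x)"
  by (simp add: Lnorm_def norm_minus_commute)

text \<open>The weight \<open>t = a / (a + b)\<close> is the optimal one in \<open>pmass_add_le\<close>.\<close>

lemma Lnorm_add_le:
  assumes g: "g \<in> Lp_funs p M" and h: "h \<in> Lp_funs p M"
  shows "Lnorm (\<lambda>x. g x + h x) \<le> Lnorm g + Lnorm h"
proof (rule field_le_epsilon)
  fix e :: real assume e: "0 < e"
  \<comment> \<open>Half of \<open>e\<close> is added to each norm to make both numbers positive, so
    that \<open>t\<close> lies strictly between \<open>0\<close> and \<open>1\<close>.\<close>
  define a b where "a = Lnorm g + e / 2" and "b = Lnorm h + e / 2"
  have ab: "0 < a" "0 < b" "Lnorm g \<le> a" "Lnorm h \<le> b"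
    using e Lnorm_nonneg[of g] Lnorm_nonneg[of h] by (auto simp: a_def b_def)
  define t where "t = a / (a + b)"
  have t: "0 < t" "t < 1" "1 - t = b / (a + b)"
    using ab by (auto simp: t_def field_simps)
  \<comment> \<open>For \<open>s = a\<close> and \<open>s = b\<close> the right-hand sides add up to
    \<open>(a + b) powr p\<close>.\<close>
  have scale: "(s / (a + b)) powr (1 - p) * s powr p = s * (a + b) powr (p - 1)" if "0 < s" for s
  proof -
    have "s powr (1 - p) * s powr p = s"
      using that by (simp flip: powr_add)
    moreover have "(a + b) powr (p - 1) = inverse ((a + b) powr (1 - p))"
      by (simp flip: powr_minus)
    moreover have "(s / (a + b)) powr (1 - p) = s powr (1 - p) / (a + b) powr (1 - p)"
      using that ab by (simp add: powr_divide)
    ultimately show ?thesis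
      by (simp add: divide_inverse mult_ac)
  qed
  have "pmass (\<lambda>x. g x + h x) \<le> ennreal (t powr (1 - p)) * pmass g + ennreal ((1 - t) powr (1 - p)) * pmass h"
    using g h t by (intro pmass_add_le)
  also have "\<dots> \<le> ennreal (t powr (1 - p)) * ennreal (a powr p) + ennreal ((1 - t) powr (1 - p)) * ennreal (b powr p)"
    using ab Lnorm_le_iff[OF g, of a] Lnorm_le_iff[OF h, of b] by (intro add_mono mult_left_mono) auto
  also have "\<dots> = ennreal (t powr (1 - p) * a powr p + (1 - t) powr (1 - p) * b powr p)"
    by (simp add: ennreal_mult)
  also have "t powr (1 - p) * a powr p + (1 - t) powr (1 - p) * b powr p = (a + b) powr (1 + (p - 1))"
    unfolding t(3) powr_add using ab scale[of a] scale[of b] by (simp add: t_def algebra_simps)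
  also have "1 + (p - 1) = p"
    by simp
  finally have "Lnorm (\<lambda>x. g x + h x) \<le> a + b"
    using ab by (subst Lnorm_le_iff) (auto intro: Lp_funs_add g h)
  then show "Lnorm (\<lambda>x. g x + h x) \<le> Lnorm g + Lnorm h + e"
    by (simp add: a_def b_def)
qed

lemma Lnorm_eq_0_iff:
  assumes "g \<in> Lp_funs p M"
  shows "Lnorm g = 0 \<longleftrightarrow> (AE x in M. g x = 0)"
proof -
  have "Lnorm g = 0 \<longleftrightarrow> (\<integral>x. norm (g x) powr p \<partial>M) = 0"
    by (simp add: Lnorm_def)
  also have "\<dots> \<longleftrightarrow> (AE x in M. norm (g x) powr p = 0)"
    using assms by (intro integral_nonneg_eq_0_iff_AE) (auto simp: Lp_funs_def)
  finally show ?thesis by simp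
qed

lemma Lnorm_cong_AE:
  assumes "g \<in> Lp_funs p M" "h \<in> Lp_funs p M" "AE x in M. g x = h x"
  shows "Lnorm g = Lnorm h"
proof -
  have "(\<integral>x. norm (g x) powr p \<partial>M) = (\<integral>x. norm (h x) powr p \<partial>M)"
    using assms by (intro integral_cong_AE) (auto simp: Lp_funs_def)
  then show ?thesis by (simp add: Lnorm_def)
qed

section \<open>Classes modulo equality almost everywhere\<close>

lemma equiv_Lp_rel: "equiv (Lp_funs p M) (Lp_rel p M)"
proof (rule equivI)
  show "Lp_rel p M \<subseteq> Lp_funs p M \<times> Lp_funs p M" "refl_on (Lp_funs p M) (Lp_rel p M)"
    by (auto simp: Lp_rel_def refl_on_def)
  show "sym (Lp_rel p M)"
    by (auto simp: Lp_rel_def sym_def elim: eventually_mono)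
  show "trans (Lp_rel p M)"
    unfolding Lp_rel_def trans_def by (auto elim: eventually_elim2)
qed

lemma Lp_class_eq_iff:
  assumes "g \<in> Lp_funs p M" "h \<in> Lp_funs p M"
  shows "Lp_class p M g = Lp_class p M h \<longleftrightarrow> (AE x in M. g x = h x)"
  unfolding Lp_class_def eq_equiv_class_iff[OF equiv_Lp_rel assms] using assms by (simp add: Lp_rel_def)

lemma mem_Lp_class: "h \<in> Lp_class p M g \<longleftrightarrow> g \<in> Lp_funs p M \<and> h \<in> Lp_funs p M \<and> (AE x in M. g x = h x)"
  by (simp add: Lp_class_def Lp_rel_def)

lemma Lp_class_eqI:
  assumes "g \<in> Lp_funs p M" "h \<in> Lp_funs p M" "AE x in M. g x = h x"
  shows "Lp_class p M h = Lp_class p M g"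
  using assms Lp_class_eq_iff by metis

lemma Lp_class_self: "g \<in> Lp_funs p M \<Longrightarrow> g \<in> Lp_class p M g"
  by (simp add: mem_Lp_class)

lemma points_Lp: "points (Lp p M) = Lp_class p M ` Lp_funs p M"
  by (auto simp: Lp_def quotient_def Lp_class_def)

lemma Lp_class_in_points: "g \<in> Lp_funs p M \<Longrightarrow> Lp_class p M g \<in> points (Lp p M)"
  by (simp add: points_Lp)

lemma Lp_pointE:
  assumes "F \<in> points (Lp p M)"
  obtains g where "g \<in> Lp_funs p M" "F = Lp_class p M g"
  using assms by (auto simp: points_Lp)

text \<open>The operations of \<open>Lp\<close> and \<open>comp_op\<close> are unions over
  representatives; once the value is independent of the representative, any single one computes
  it.\<close>

lemma UN_Lp_class:
  assumes "g \<in> Lp_funs p M"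
    and "\<And>g'. g' \<in> Lp_funs p M \<Longrightarrow> AE x in M. g x = g' x \<Longrightarrow> B g' = B g"
  shows "(\<Union>g'\<in>Lp_class p M g. B g') = B g"
proof -
  have "B g' = B g" if "g' \<in> Lp_class p M g" for g'
    using that by (intro assms(2)) (simp_all add: mem_Lp_class)
  then have "(\<Union>g'\<in>Lp_class p M g. B g') = (\<Union>g'\<in>Lp_class p M g. B g)"
    by (intro SUP_cong) auto
  also have "\<dots> = B g"
    using Lp_class_self[OF assms(1)] by auto
  finally show ?thesis .
qed

lemma vadd_Lp:
  assumes g: "g \<in> Lp_funs p M" and h: "h \<in> Lp_funs p M"
  shows "vadd (Lp p M) (Lp_class p M g) (Lp_class p M h) = Lp_class p M (\<lambda>x. g x + h x)"
proof -
  have inner: "(\<Union>h'\<in>Lp_class p M h. Lp_class p M (\<lambda>x. g' x + h' x)) = Lp_class p M (\<lambda>x. g' x + h x)"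
    if "g' \<in> Lp_funs p M" for g'
    by (rule UN_Lp_class[of h "\<lambda>h'. Lp_class p M (\<lambda>x. g' x + h' x)", OF h],
        rule Lp_class_eqI) (use that h in \<open>auto intro: Lp_funs_add\<close>)
  have "(\<Union>g'\<in>Lp_class p M g. \<Union>h'\<in>Lp_class p M h. Lp_class p M (\<lambda>x. g' x + h' x))
      = (\<Union>g'\<in>Lp_class p M g. Lp_class p M (\<lambda>x. g' x + h x))"
    by (intro SUP_cong refl inner) (simp add: mem_Lp_class)
  also have "\<dots> = Lp_class p M (\<lambda>x. g x + h x)"
    by (rule UN_Lp_class[of g "\<lambda>g'. Lp_class p M (\<lambda>x. g' x + h x)", OF g],
        rule Lp_class_eqI) (use g h in \<open>auto intro: Lp_funs_add\<close>)
  finally show ?thesis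
    by (simp add: Lp_def)
qed

lemma vscale_Lp:
  assumes g: "g \<in> Lp_funs p M"
  shows "vscale (Lp p M) c (Lp_class p M g) = Lp_class p M (\<lambda>x. c * g x)"
proof -
  have "(\<Union>g'\<in>Lp_class p M g. Lp_class p M (\<lambda>x. c * g' x)) = Lp_class p M (\<lambda>x. c * g x)"
    by (rule UN_Lp_class[of g "\<lambda>g'. Lp_class p M (\<lambda>x. c * g' x)", OF g],
        rule Lp_class_eqI) (use g in \<open>auto intro: Lp_funs_scale elim: eventually_mono\<close>)
  then show ?thesis
    by (simp add: Lp_def)
qed

lemma vsub_Lp:
  assumes "g \<in> Lp_funs p M" "h \<in> Lp_funs p M"
  shows "vadd (Lp p M) (Lp_class p M g) (vscale (Lp p M) (- 1) (Lp_class p M h))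
    = Lp_class p M (\<lambda>x. g x - h x)"
  using assms vadd_Lp[of g "\<lambda>x. - 1 * h x"] Lp_funs_scale[of h "- 1"] by (simp add: vscale_Lp)

lemma vnorm_Lp:
  assumes "g \<in> Lp_funs p M"
  shows "vnorm (Lp p M) (Lp_class p M g) = Lnorm g"
proof -
  have "the_elem (Lnorm ` Lp_class p M g) = Lnorm g"
  proof (rule the_elem_image_unique)
    show "Lnorm h = Lnorm g" if "h \<in> Lp_class p M g" for h
      using that by (intro Lnorm_cong_AE[symmetric]) (simp_all add: mem_Lp_class)
  qed (use Lp_class_self[OF assms] in blast)
  then show ?thesis
    by (simp add: Lp_def Lnorm_def[abs_def])
qed

lemma vdist_Lp:
  assumes "g \<in> Lp_funs p M" "h \<in> Lp_funs p M"
  shows "vdist (Lp p M) (Lp_class p M g) (Lp_class p M h) = Lnorm (\<lambda>x. g x - h x)"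
  using assms by (simp add: vdist_def Lp_class_in_points vsub_Lp vnorm_Lp Lp_funs_diff)

lemma Metric_space_Lp: "Metric_space (points (Lp p M)) (vdist (Lp p M))"
proof
  fix F G
  show "0 \<le> vdist (Lp p M) F G"
    by (cases "F \<in> points (Lp p M) \<and> G \<in> points (Lp p M)")
      (auto elim!: Lp_pointE simp: vdist_Lp Lnorm_nonneg, simp_all add: vdist_def)
  show "vdist (Lp p M) F G = vdist (Lp p M) G F"
    by (cases "F \<in> points (Lp p M) \<and> G \<in> points (Lp p M)")
      (auto elim!: Lp_pointE simp: vdist_Lp intro: Lnorm_minus, simp_all add: vdist_def)
next
  fix F G assume "F \<in> points (Lp p M)" "G \<in> points (Lp p M)"
  then obtain g h where gh: "g \<in> Lp_funs p M" "F = Lp_class p M g" "h \<in> Lp_funs p M" "G = Lp_class p M h"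
    by (metis Lp_pointE)
  then show "vdist (Lp p M) F G = 0 \<longleftrightarrow> F = G"
    by (simp add: vdist_Lp Lnorm_eq_0_iff Lp_funs_diff Lp_class_eq_iff)
next
  fix F G H assume "F \<in> points (Lp p M)" "G \<in> points (Lp p M)" "H \<in> points (Lp p M)"
  then obtain g h k where ghk: "g \<in> Lp_funs p M" "F = Lp_class p M g"
      "h \<in> Lp_funs p M" "G = Lp_class p M h" "k \<in> Lp_funs p M" "H = Lp_class p M k"
    by (metis Lp_pointE)
  have "Lnorm (\<lambda>x. (g x - h x) + (h x - k x)) \<le> Lnorm (\<lambda>x. g x - h x) + Lnorm (\<lambda>x. h x - k x)"
    using ghk by (intro Lnorm_add_le Lp_funs_diff)
  then show "vdist (Lp p M) F H \<le> vdist (Lp p M) F G + vdist (Lp p M) G H"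
    using ghk by (simp add: vdist_Lp)
qed

section \<open>Completeness\<close>

text \<open>Even after multiplication by \<open>2 ^ n\<close>, the \<open>p\<close>-th powers of the
  increments have a summable integral. Hence almost everywhere the increments are
  \<open>O((1 / 2) ^ n)\<close>, and their series converges absolutely.\<close>

lemma rapidly_Cauchy_converges_AE:
  assumes u: "\<And>n. u n \<in> Lp_funs p M"
    and fast: "\<And>n. Lnorm (\<lambda>x. u (Suc n) x - u n x) \<le> (1 / 4) ^ n"
  shows "AE x in M. convergent (\<lambda>n. u n x)"
proof -
  have [measurable]: "u n \<in> borel_measurable M" for n
    using u Lp_funs_measurable by blast
  define D where "D n x = u (Suc n) x - u n x" for n x
  have [measurable]: "D n \<in> borel_measurable M" for n
    unfolding D_def[abs_def] by measurable
  have summand: "(\<integral>\<^sup>+x. ennreal (norm (2 ^ n * D n x) powr p) \<partial>M) \<le> ennreal ((1 / 2) ^ n)" for n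
  proof -
    have "(\<integral>\<^sup>+x. ennreal (norm (2 ^ n * D n x) powr p) \<partial>M) = ennreal ((2 ^ n) powr p) * pmass (D n)"
      using pmass_scale[of "D n" "2 ^ n"] by (simp add: pmass_def norm_power)
    also have "\<dots> \<le> ennreal ((2 ^ n) powr p) * ennreal (((1 / 4) ^ n) powr p)"
      using fast[of n] Lnorm_le_iff[of "D n" "(1 / 4) ^ n"] u
      by (intro mult_left_mono) (auto simp: D_def[abs_def] Lp_funs_diff)
    also have "\<dots> = ennreal (((1 / 2) ^ n) powr p)"
      by (simp flip: ennreal_mult powr_mult power_mult_distrib)
    also have "\<dots> \<le> ennreal ((1 / 2) ^ n)"
    proof -
      have "((1 / 2) ^ n :: real) powr p \<le> ((1 / 2) ^ n) powr 1"
        using exponent by (intro powr_mono') (auto simp: power_le_one)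
      then show ?thesis by (simp add: ennreal_leI)
    qed
    finally show ?thesis .
  qed
  have "(\<integral>\<^sup>+x. (\<Sum>n. ennreal (norm (2 ^ n * D n x) powr p)) \<partial>M)
      = (\<Sum>n. \<integral>\<^sup>+x. ennreal (norm (2 ^ n * D n x) powr p) \<partial>M)"
    by (intro nn_integral_suminf) measurable
  also have "\<dots> \<le> (\<Sum>n. ennreal ((1 / 2) ^ n))"
    using summand by (intro suminf_le) auto
  also have "\<dots> = ennreal (\<Sum>n. (1 / 2) ^ n)"
    by (intro suminf_ennreal2) (auto intro: summable_geometric)
  also have "\<dots> < \<infinity>"
    by simp
  finally have "AE x in M. (\<Sum>n. ennreal (norm (2 ^ n * D n x) powr p)) \<noteq> \<infinity>"
    by (intro nn_integral_PInf_AE) auto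
  then show ?thesis
  proof eventually_elim
    case (elim x)
    have "\<exists>S\<ge>0. t = ennreal S" if "t \<noteq> \<infinity>" for t :: ennreal
      using that by (cases t) auto
    from this[OF elim] obtain S
      where S: "(\<Sum>n. ennreal (norm (2 ^ n * D n x) powr p)) = ennreal S" "0 \<le> S"
      by blast
    have D_le: "norm (D n x) \<le> S powr (1 / p) * (1 / 2) ^ n" for n
    proof -
      have "ennreal (norm (2 ^ n * D n x) powr p) \<le> ennreal S"
      proof -
        let ?e = "\<lambda>n. ennreal (norm (2 ^ n * D n x) powr p)"
        have "sum ?e {n} \<le> suminf ?e"
          by (rule sum_le_suminf) (rule summableI, rule finite.intros(2), rule finite.intros(1), rule zero_le)
        also have "suminf ?e = ennreal S"
          by (rule S(1))
        finally show ?thesis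
          by simp
      qed
      then have "norm (2 ^ n * D n x) powr p \<le> S"
        using S(2) by simp
      then have "(norm (2 ^ n * D n x) powr p) powr (1 / p) \<le> S powr (1 / p)"
        using exponent by (intro powr_mono2) auto
      then have "2 ^ n * norm (D n x) \<le> S powr (1 / p)"
        using exponent by (simp add: powr_powr norm_mult norm_power)
      then show ?thesis
        by (simp add: field_simps)
    qed
    have "summable (\<lambda>n. S powr (1 / p) * (1 / 2) ^ n)"
      by (intro summable_mult summable_geometric) auto
    then have "summable (\<lambda>n. D n x)"
      by (rule summable_comparison_test') (rule D_le)
    then have "convergent (\<lambda>n. \<Sum>i<n. D i x)"
      by (simp add: summable_iff_convergent)
    then have "convergent (\<lambda>n. u 0 x + (\<Sum>i<n. D i x))"
      by (intro convergent_add convergent_const)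
    moreover have "u 0 x + (\<Sum>i<n. D i x) = u n x" for n
      by (simp add: D_def sum_lessThan_telescope[of "\<lambda>i. u i x"])
    ultimately show "convergent (\<lambda>n. u n x)"
      by simp
  qed
qed

text \<open>Fatou's lemma for the \<open>p\<close>-th powers.\<close>

lemma pmass_limit_le:
  assumes u: "\<And>n. u n \<in> borel_measurable M" and v: "v \<in> borel_measurable M"
    and lim: "AE x in M. (\<lambda>n. u n x) \<longlonglongrightarrow> v x"
    and bound: "\<forall>\<^sub>F n in sequentially. pmass (u n) \<le> r"
  shows "pmass v \<le> r"
proof -
  have "pmass v = (\<integral>\<^sup>+x. liminf (\<lambda>n. ennreal (norm (u n x) powr p)) \<partial>M)"
    unfolding pmass_def
  proof (rule nn_integral_cong_AE, use lim in eventually_elim)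
    case (elim x)
    have "(\<lambda>n. ennreal (norm (u n x) powr p)) \<longlonglongrightarrow> ennreal (norm (v x) powr p)"
      using elim exponent by (intro tendsto_ennrealI tendsto_powr2 tendsto_norm tendsto_const) auto
    then show ?case
      by (rule lim_imp_Liminf[OF trivial_limit_sequentially, symmetric])
  qed
  also have "\<dots> \<le> liminf (\<lambda>n. pmass (u n))"
    unfolding pmass_def using u by (intro nn_integral_liminf) auto
  also have "\<dots> \<le> r"
    using bound by (intro Liminf_le) auto
  finally show ?thesis .
qed

text \<open>The Riesz-Fischer argument: a fast subsequence converges almost everywhere, Fatou turns
  this into convergence in norm, and a Cauchy sequence with a convergent subsequence
  converges.\<close>

lemma mcomplete_Lp: "Metric_space.mcomplete (points (Lp p M)) (vdist (Lp p M))"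
proof -
  interpret Metric_space "points (Lp p M)" "vdist (Lp p M)"
    by (rule Metric_space_Lp)
  show ?thesis
    unfolding mcomplete_def
  proof (intro allI impI)
    fix \<sigma> assume \<sigma>: "MCauchy \<sigma>"
    have "\<exists>g. g \<in> Lp_funs p M \<and> \<sigma> n = Lp_class p M g" for n
      using \<sigma> by (metis MCauchy_def Lp_pointE range_subsetD)
    then obtain g where g: "\<And>n. g n \<in> Lp_funs p M" "\<And>n. \<sigma> n = Lp_class p M (g n)"
      by metis
    have "\<exists>N. \<forall>n n'. N \<le> n \<longrightarrow> N \<le> n' \<longrightarrow> vdist (Lp p M) (\<sigma> n) (\<sigma> n') < (1 / 4) ^ k" for k
      using \<sigma> by (simp add: MCauchy_def)
    then obtain N where N: "\<And>k n n'. N k \<le> n \<Longrightarrow> N k \<le> n' \<Longrightarrow> vdist (Lp p M) (\<sigma> n) (\<sigma> n') < (1 / 4) ^ k"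
      by metis
    \<comment> \<open>The sum puts \<open>r k\<close> beyond \<open>N i\<close> for all
      \<open>i <= k\<close>, and the summand \<open>k\<close> makes \<open>r\<close> strictly
      increasing.\<close>
    define r where "r k = k + (\<Sum>i\<le>k. N i)" for k
    have r: "strict_mono r"
      unfolding strict_mono_Suc_iff by (simp add: r_def)
    have rN: "N k \<le> r n" if "k \<le> n" for k n
      unfolding r_def using that by (intro trans_le_add2 member_le_sum) auto
    define u where "u k = g (r k)" for k
    have u: "u k \<in> Lp_funs p M" for k
      by (simp add: u_def g)
    have [measurable]: "u k \<in> borel_measurable M" for k
      using u Lp_funs_measurable by blast
    have close: "Lnorm (\<lambda>x. u n x - u k x) \<le> (1 / 4) ^ k" if "k \<le> n" for k n
      using N[of k "r n" "r k"] rN[OF that] rN[of k k] g by (simp add: u_def vdist_Lp)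
    define v where "v x = lim (\<lambda>n. u n x)" for x
    have [measurable]: "v \<in> borel_measurable M"
      unfolding v_def by measurable
    have "AE x in M. convergent (\<lambda>n. u n x)"
      using close by (intro rapidly_Cauchy_converges_AE u) auto
    then have uv: "AE x in M. (\<lambda>n. u n x) \<longlonglongrightarrow> v x"
      by (simp add: v_def convergent_LIMSEQ_iff)
    have tail: "pmass (\<lambda>x. v x - u k x) \<le> ennreal (((1 / 4) ^ k) powr p)" for k
    proof (rule pmass_limit_le)
      show "AE x in M. (\<lambda>n. u n x - u k x) \<longlonglongrightarrow> v x - u k x"
        using uv by eventually_elim (intro tendsto_diff tendsto_const)
      show "\<forall>\<^sub>F n in sequentially. pmass (\<lambda>x. u n x - u k x) \<le> ennreal (((1 / 4) ^ k) powr p)"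
        using close u by (intro eventually_sequentiallyI[of k]) (simp add: Lnorm_le_iff[symmetric] Lp_funs_diff)
    qed auto
    have vu: "(\<lambda>x. v x - u k x) \<in> Lp_funs p M" for k
      using tail[of k] by (auto simp: Lp_funs_iff intro: le_less_trans)
    have v: "v \<in> Lp_funs p M"
      using Lp_funs_add[OF vu[of 0] u[of 0]] by simp
    have dist: "vdist (Lp p M) (\<sigma> (r k)) (Lp_class p M v) \<le> (1 / 4) ^ k" for k
    proof -
      have "vdist (Lp p M) (Lp_class p M v) (\<sigma> (r k)) = Lnorm (\<lambda>x. v x - u k x)"
        using v g by (simp add: u_def vdist_Lp)
      also have "\<dots> \<le> (1 / 4) ^ k"
        using tail[of k] vu[of k] by (simp add: Lnorm_le_iff)
      finally show ?thesis
        by (simp add: commute)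
    qed
    have "limitin mtopology (\<sigma> \<circ> r) (Lp_class p M v) sequentially"
      unfolding limitin_metric_dist_null
    proof (intro conjI)
      show "(\<lambda>k. vdist (Lp p M) ((\<sigma> \<circ> r) k) (Lp_class p M v)) \<longlonglongrightarrow> 0"
        by (rule tendsto_sandwich[of "\<lambda>_. 0" _ _ "\<lambda>k. (1 / 4) ^ k"])
          (use dist in \<open>auto intro: LIMSEQ_realpow_zero\<close>)
    qed (use v g in \<open>auto simp: Lp_class_in_points\<close>)
    then show "\<exists>x. limitin mtopology \<sigma> x sequentially"
      using MCauchy_convergent_subsequence[OF \<sigma> r] by blast
  qed
qed

lemma complete_nspace_Lp: "complete_nspace (Lp p M)"
proof (rule complete_nspace.intro)
  fix F G assume "F \<in> points (Lp p M)" "G \<in> points (Lp p M)"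
  then obtain g h where gh: "g \<in> Lp_funs p M" "F = Lp_class p M g" "h \<in> Lp_funs p M" "G = Lp_class p M h"
    by (metis Lp_pointE)
  show "vadd (Lp p M) F G \<in> points (Lp p M)"
    using gh by (simp add: vadd_Lp Lp_class_in_points Lp_funs_add)
  show "vadd (Lp p M) F G = vadd (Lp p M) G F"
    using gh by (simp add: vadd_Lp add.commute)
  show "vdist (Lp p M) (vadd (Lp p M) F G) F = vnorm (Lp p M) G"
    using gh by (simp add: vadd_Lp vdist_Lp vnorm_Lp Lp_funs_add)
  show "vadd (Lp p M) F (vscale (Lp p M) (- 1) G) \<in> points (Lp p M)"
    using gh by (simp add: vsub_Lp Lp_class_in_points Lp_funs_diff)
  show "vadd (Lp p M) (vadd (Lp p M) F (vscale (Lp p M) (- 1) G)) G = F"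
    using gh by (simp add: vsub_Lp vadd_Lp Lp_funs_diff)
next
  fix F G H assume "F \<in> points (Lp p M)" "G \<in> points (Lp p M)" "H \<in> points (Lp p M)"
  then obtain g h k where ghk: "g \<in> Lp_funs p M" "F = Lp_class p M g"
      "h \<in> Lp_funs p M" "G = Lp_class p M h" "k \<in> Lp_funs p M" "H = Lp_class p M k"
    by (metis Lp_pointE)
  then show "vdist (Lp p M) (vadd (Lp p M) F H) (vadd (Lp p M) G H) = vdist (Lp p M) F G"
    by (simp add: vadd_Lp vdist_Lp Lp_funs_add)
qed (rule Metric_space_Lp mcomplete_Lp)+

end

section \<open>Dissipative systems of bounded distortion\<close>

text \<open>The hypothesis says that the push-forward under \<open>G\<close> of the measure
  restricted to \<open>S\<close> lies below \<open>r\<close> times the measure restricted to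
  \<open>S'\<close>; integrals are monotone in the measure.\<close>

lemma nn_integral_transport_le:
  assumes G: "G \<in> measurable M M" and S: "S \<in> sets M" "S' \<in> sets M"
    and le: "\<And>A. A \<in> sets M \<Longrightarrow>
      emeasure M (G -` A \<inter> space M \<inter> S) \<le> r * emeasure M (A \<inter> S')"
    and u: "u \<in> borel_measurable M"
  shows "(\<integral>\<^sup>+x. indicator S x * u (G x) \<partial>M) \<le> r * (\<integral>\<^sup>+x. indicator S' x * u x \<partial>M)"
proof -
  note [measurable] = G S u
  let ?N = "distr (density M (indicator S)) M G"
  let ?N' = "scale_measure r (density M (indicator S'))"
  have dens: "emeasure (density M (indicator B)) A = emeasure M (A \<inter> B)"
    if "A \<in> sets M" "B \<in> sets M" for A B
    using that by (simp add: emeasure_density indicator_inter_arith[symmetric] Int_commute)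
  have "?N \<le> ?N'"
  proof (subst le_measure, simp, intro ballI)
    fix A assume "A \<in> sets ?N"
    then have [measurable]: "A \<in> sets M" by simp
    have "emeasure ?N A = emeasure M (G -` A \<inter> space M \<inter> S)"
      by (subst emeasure_distr) (auto simp: dens)
    then show "emeasure ?N A \<le> emeasure ?N' A"
      using le[of A] by (simp add: dens)
  qed
  then have "nn_integral ?N u \<le> nn_integral ?N' u"
    by (intro nn_integral_mono_measure) simp
  then show ?thesis
    by (simp add: nn_integral_distr nn_integral_scale_measure nn_integral_density)
qed

lemma AE_transport:
  assumes G: "G \<in> measurable M M"
    and le: "\<And>A. A \<in> sets M \<Longrightarrow> emeasure M (G -` A \<inter> space M) \<le> r * emeasure M A"
    and P: "AE x in M. P x"
  shows "AE x in M. P (G x)"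
proof -
  obtain N where N: "{x \<in> space M. \<not> P x} \<subseteq> N" "emeasure M N = 0" "N \<in> sets M"
    using P by (rule AE_E)
  have "emeasure M (G -` N \<inter> space M) = 0"
    using le[OF N(3)] N(2) by simp
  moreover have "{x \<in> space M. \<not> P (G x)} \<subseteq> G -` N \<inter> space M"
    using N(1) measurable_space[OF G] by auto
  ultimately show ?thesis
    using measurable_sets[OF G N(3)] by (intro AE_I)
qed

sublocale composition_system \<subseteq> Lp_space M p
  by unfold_locales (rule p_ge_1)

locale invertible_dissipative_system = dissipative_bounded_distortion_system M f p W
  for M :: "'a measure" and f :: "'a \<Rightarrow> 'a" and p :: real and W :: "'a set" +
  assumes invertible: "invertible_composition M f"
begin

section \<open>Integer iterates of the transformation\<close>

abbreviation "F \<equiv> ziter (space M) f"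

lemma F_0: "F 0 x = x"
  by (simp add: ziter_def)

lemma F_int: "F (int n) = f ^^ n"
  by (simp add: ziter_def)

lemma F_minus_int: "F (- int n) = inv_into (space M) f ^^ n"
  by (cases "n = 0") (auto simp: ziter_def)

lemma f_closed: "x \<in> space M \<Longrightarrow> f x \<in> space M"
  using maps_to by auto

lemma inv_f_closed: "x \<in> space M \<Longrightarrow> inv_into (space M) f x \<in> space M"
  using bijective by (metis bij_betw_def inv_into_into)

lemma f_inv_f: "x \<in> space M \<Longrightarrow> f (inv_into (space M) f x) = x"
  using bijective by (metis bij_betw_inv_into_right)

lemma F_closed:
  assumes "x \<in> space M"
  shows "F k x \<in> space M"
proof -
  have "(f ^^ n) x \<in> space M" "(inv_into (space M) f ^^ n) x \<in> space M" for n
    using assms by (induction n) (auto intro: f_closed inv_f_closed)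
  then show ?thesis
    by (simp add: ziter_def)
qed

lemma F_Suc:
  assumes "x \<in> space M"
  shows "F (k + 1) x = f (F k x)"
proof (cases k)
  case (nonneg n)
  have "k + 1 = int (Suc n)"
    using nonneg by simp
  then show ?thesis
    using nonneg by (simp only: F_int funpow.simps comp_apply)
next
  case (neg n)
  have "f (F k x) = f (inv_into (space M) f ((inv_into (space M) f ^^ n) x))"
    unfolding neg F_minus_int by simp
  also have "\<dots> = F (- int n) x"
    using F_closed[OF assms, of "- int n"] by (simp add: F_minus_int f_inv_f)
  also have "- int n = k + 1"
    using neg by simp
  finally show ?thesis ..
qed

lemma F_add:
  assumes "x \<in> space M"
  shows "F (j + k) x = F j (F k x)"
proof (induction j rule: int_induct[where k = 0])
  case base
  show ?case by (simp add: F_0)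
next
  case (step1 j)
  then show ?case
    using F_Suc[of x "j + k"] F_Suc[of "F k x" j] assms F_closed by (simp add: algebra_simps)
next
  case (step2 j)
  have "f (F (j - 1 + k) x) = f (F (j - 1) (F k x))"
    using step2 F_Suc[of x "j - 1 + k"] F_Suc[of "F k x" "j - 1"] assms F_closed
    by (simp add: algebra_simps)
  then show ?case
    using injective assms F_closed by (meson inj_onD)
qed

lemma F_inverse: "x \<in> space M \<Longrightarrow> F (- k) (F k x) = x" "x \<in> space M \<Longrightarrow> F k (F (- k) x) = x"
  using F_add[of x "- k" k] F_add[of x k "- k"] by (simp_all add: F_0)

lemma F_image_add: "A \<subseteq> space M \<Longrightarrow> F j ` F k ` A = F (j + k) ` A"
  by (auto simp: image_image F_add subset_iff intro!: image_cong)

lemma F_image_0: "F 0 ` A = A"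
  by (auto simp: F_0)

lemma F_vimage: "A \<subseteq> space M \<Longrightarrow> F k -` A \<inter> space M = F (- k) ` A"
  by (auto simp: F_closed F_inverse subset_iff image_iff) (metis F_inverse(1))

lemma F_1: "F 1 = f" and F_minus_1: "F (- 1) = inv_into (space M) f"
  using F_int[of 1] F_minus_int[of 1] by simp_all

lemma F_bound_step:
  obtains c where "1 \<le> c"
    "\<And>A. A \<in> sets M \<Longrightarrow> F 1 ` A \<in> sets M \<and> emeasure M (F 1 ` A) \<le> ennreal c * emeasure M A"
    "\<And>A. A \<in> sets M \<Longrightarrow> F (- 1) ` A \<in> sets M \<and> emeasure M (F (- 1) ` A) \<le> ennreal c * emeasure M A"
proof -
  obtain c1 where c1: "\<And>B. B \<in> sets M \<Longrightarrow> emeasure M (f -` B \<inter> space M) \<le> ennreal c1 * emeasure M B"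
    using preimage_bound by blast
  obtain c2 where c2: "\<And>B. B \<in> sets M \<Longrightarrow> emeasure M (f ` B) \<le> ennreal c2 * emeasure M B"
    using invertible unfolding invertible_composition_def by blast
  have pre: "F (- 1) ` A = f -` A \<inter> space M" if "A \<in> sets M" for A
    using F_vimage[of A 1] sets.sets_into_space[OF that] by (simp add: F_1)
  have mono: "ennreal c * m \<le> ennreal (max 1 (max c1 c2)) * m" if "c = c1 \<or> c = c2" for c m
    using that by (intro mult_right_mono ennreal_leI) auto
  show thesis
  proof
    show "1 \<le> max 1 (max c1 c2)" by simp
    fix A assume A: "A \<in> sets M"
    show "F 1 ` A \<in> sets M \<and> emeasure M (F 1 ` A) \<le> ennreal (max 1 (max c1 c2)) * emeasure M A"
      using image_measurable[OF A] order_trans[OF c2[OF A] mono] by (simp add: F_1)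
    show "F (- 1) ` A \<in> sets M \<and> emeasure M (F (- 1) ` A) \<le> ennreal (max 1 (max c1 c2)) * emeasure M A"
      using preimage_measurable[OF A] order_trans[OF c1[OF A] mono] by (simp add: pre A)
  qed
qed

text \<open>The one-step bounds for \<open>f\<close> and its inverse are composed, so a power
  \<open>c ^ |k|\<close> of the common one-step constant works.\<close>

lemma F_bound:
  "\<exists>c::real. 0 \<le> c \<and>
    (\<forall>A\<in>sets M. F k ` A \<in> sets M \<and> emeasure M (F k ` A) \<le> ennreal c * emeasure M A)"
proof -
  obtain c where c: "1 \<le> c"
    "\<And>A. A \<in> sets M \<Longrightarrow> F 1 ` A \<in> sets M \<and> emeasure M (F 1 ` A) \<le> ennreal c * emeasure M A"
    "\<And>A. A \<in> sets M \<Longrightarrow> F (- 1) ` A \<in> sets M \<and> emeasure M (F (- 1) ` A) \<le> ennreal c * emeasure M A"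
    by (rule F_bound_step) blast
  have step: "F (j + e) ` A \<in> sets M \<and> emeasure M (F (j + e) ` A) \<le> ennreal (c ^ Suc n) * emeasure M A"
    if A: "A \<in> sets M" and e: "e = 1 \<or> e = - 1"
      and IH: "F j ` A \<in> sets M \<and> emeasure M (F j ` A) \<le> ennreal (c ^ n) * emeasure M A" for A j e n
  proof -
    have "F (j + e) ` A = F e ` F j ` A"
      using sets.sets_into_space[OF A] by (simp add: F_image_add add.commute)
    moreover have "F e ` F j ` A \<in> sets M \<and> emeasure M (F e ` F j ` A) \<le> ennreal c * emeasure M (F j ` A)"
      using c(2,3) IH e by blast
    moreover have "ennreal c * emeasure M (F j ` A) \<le> ennreal c * (ennreal (c ^ n) * emeasure M A)"
      using IH by (intro mult_left_mono) auto
    moreover have "ennreal c * (ennreal (c ^ n) * emeasure M A) = ennreal (c ^ Suc n) * emeasure M A"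
      using c(1) by (simp add: ennreal_mult mult.assoc)
    ultimately show ?thesis
      by auto
  qed
  have "F (int n) ` A \<in> sets M \<and> emeasure M (F (int n) ` A) \<le> ennreal (c ^ n) * emeasure M A"
    if "A \<in> sets M" for A n
  proof (induction n)
    case 0
    then show ?case using that F_image_0 by simp
  next
    case (Suc n)
    then show ?case using step[OF that _ Suc, of 1] by (simp add: add.commute)
  qed
  moreover have "F (- int n) ` A \<in> sets M \<and> emeasure M (F (- int n) ` A) \<le> ennreal (c ^ n) * emeasure M A"
    if "A \<in> sets M" for A n
  proof (induction n)
    case 0
    then show ?case using that F_image_0 by simp
  next
    case (Suc n)
    then show ?case using step[OF that _ Suc, of "- 1"] by (simp add: algebra_simps)
  qed
  moreover obtain n where "k = int n \<or> k = - int n"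
    by (metis int_cases2)
  ultimately show ?thesis
    using c(1) by (intro exI[of _ "c ^ n"]) auto
qed

lemma F_image_sets: "A \<in> sets M \<Longrightarrow> F k ` A \<in> sets M"
  using F_bound by blast

lemma F_measurable: "F k \<in> measurable M M"
  by (rule measurableI) (auto simp: F_closed F_vimage sets.sets_into_space F_image_sets)

section \<open>The translates of \<open>W\<close> and their distortion\<close>

definition cell :: "int \<Rightarrow> 'a set" where
  "cell k = F k ` W"

lemma cell_sets: "cell k \<in> sets M"
  unfolding cell_def by (rule F_image_sets[OF W_measurable])

lemma F_image_cell: "F m ` cell k = cell (k + m)"
  using sets.sets_into_space[OF W_measurable] by (simp add: cell_def F_image_add add.commute)

lemma cell_subset: "cell k \<subseteq> space M"
  using cell_sets sets.sets_into_space by blast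

lemma cell_unique: "x \<in> cell j \<Longrightarrow> x \<in> cell k \<Longrightarrow> j = k"
  using W_disjoint unfolding cell_def disjoint_family_on_def by blast

lemma F_mem_cell_iff:
  assumes "x \<in> cell k"
  shows "F m x \<in> cell j \<longleftrightarrow> j = k + m"
proof -
  have "F m x \<in> cell (k + m)"
    using assms F_image_cell by blast
  then show ?thesis
    using cell_unique by blast
qed

text \<open>If \<open>cell k\<close> were null, so would be its image \<open>W\<close> under
  \<open>F (- k)\<close>, by \<open>F_bound\<close>.\<close>

lemma emeasure_cell_pos: "0 < emeasure M (cell k)"
proof -
  obtain c where c: "\<And>A. A \<in> sets M \<Longrightarrow> emeasure M (F (- k) ` A) \<le> ennreal c * emeasure M A"
    using F_bound[of "- k"] by blast
  have "F (- k) ` cell k = W"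
    using F_image_cell[of "- k" k] by (simp add: cell_def F_image_0)
  then show ?thesis
    using c[OF cell_sets[of k]] W_pos by (metis gr_zeroI le_zero_eq mult_zero_right not_gr_zero)
qed

lemma emeasure_cell_finite: "emeasure M (cell k) < \<infinity>"
proof -
  obtain c where "emeasure M (F k ` W) \<le> ennreal c * emeasure M W"
    using F_bound[of k] W_measurable by blast
  also have "\<dots> < \<infinity>"
    using W_finite by (simp add: ennreal_mult_less_top)
  finally show ?thesis
    by (simp add: cell_def)
qed

text \<open>Changing the reference set from \<open>W\<close> to an arbitrary cell squares the
  constant: for \<open>B = F (- k)\<close> followed by taking the image of \<open>A\<close>, the
  lower distortion bound is used at time \<open>k\<close> and the upper one at time
  \<open>k + m\<close>.\<close>

lemma cell_distortion:
  obtains K :: real where "0 < K"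
    "\<And>k m A. A \<in> sets M \<Longrightarrow> A \<subseteq> cell k \<Longrightarrow>
      emeasure M (F m ` A) * emeasure M (cell k) \<le> ennreal K * (emeasure M (cell (k + m)) * emeasure M A)"
proof -
  obtain K :: real where K: "0 < K"
    and dist: "\<And>k B. B \<in> {A \<inter> W |A. A \<in> sets M} \<Longrightarrow>
         ennreal (1 / K) * (emeasure M (F k ` W) * emeasure M B) \<le> emeasure M (F k ` B) * emeasure M W \<and>
         emeasure M (F k ` B) * emeasure M W \<le> ennreal K * (emeasure M (F k ` W) * emeasure M B)"
    using bounded_distortion by blast
  show thesis
  proof
    show "0 < K * K"
      using K by simp
    fix k m A assume A: "A \<in> sets M" "A \<subseteq> cell k"
    define B where "B = F (- k) ` A"
    have AM: "A \<subseteq> space M"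
      using A(1) by (rule sets.sets_into_space)
    have FB: "F k ` B = A" "F (k + m) ` B = F m ` A"
      unfolding B_def by (simp_all add: F_image_add AM F_image_0)
    have "B \<subseteq> F (- k) ` cell k"
      unfolding B_def using A(2) by blast
    then have "B \<subseteq> W"
      using F_image_cell[of "- k" k] by (simp add: cell_def F_image_0)
    then have B: "B \<in> {A \<inter> W |A. A \<in> sets M}"
      using F_image_sets[OF A(1)] unfolding B_def by blast
    define w where "w = emeasure M W"
    have w: "w \<noteq> 0" "w < top"
      using W_pos W_finite by (auto simp: w_def)
    have "emeasure M (cell k) * emeasure M B = ennreal K * (ennreal (1 / K) * (emeasure M (cell k) * emeasure M B))"
      using K by (simp add: mult.assoc[symmetric] ennreal_mult[symmetric])
    also have "\<dots> \<le> ennreal K * (emeasure M A * w)"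
      using dist[OF B, of k] by (intro mult_left_mono) (auto simp: cell_def FB w_def)
    finally have up: "emeasure M (cell k) * emeasure M B \<le> ennreal K * (emeasure M A * w)" .
    have "w * (emeasure M (F m ` A) * emeasure M (cell k)) = (emeasure M (F m ` A) * w) * emeasure M (cell k)"
      by (simp add: mult_ac)
    also have "\<dots> \<le> (ennreal K * (emeasure M (cell (k + m)) * emeasure M B)) * emeasure M (cell k)"
      using dist[OF B, of "k + m"] by (intro mult_right_mono) (auto simp: cell_def FB w_def)
    also have "\<dots> = (ennreal K * emeasure M (cell (k + m))) * (emeasure M (cell k) * emeasure M B)"
      by (simp add: mult_ac)
    also have "\<dots> \<le> (ennreal K * emeasure M (cell (k + m))) * (ennreal K * (emeasure M A * w))"
      using up by (rule mult_left_mono) simp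
    also have "\<dots> = w * (ennreal (K * K) * (emeasure M (cell (k + m)) * emeasure M A))"
      using K by (simp add: ennreal_mult mult_ac)
    finally show "emeasure M (F m ` A) * emeasure M (cell k)
        \<le> ennreal (K * K) * (emeasure M (cell (k + m)) * emeasure M A)"
      using w by (simp add: ennreal_mult_le_mult_iff)
  qed
qed

lemma nn_integral_cell_distortion:
  obtains K :: real where "0 < K"
    "\<And>k m u. u \<in> borel_measurable M \<Longrightarrow>
      (\<integral>\<^sup>+x. indicator (cell (k + m)) x * u x \<partial>M) * emeasure M (cell k)
        \<le> ennreal K * emeasure M (cell (k + m)) * (\<integral>\<^sup>+x. indicator (cell k) x * u (F m x) \<partial>M)"
proof -
  obtain K :: real where K: "0 < K"
    and dist: "\<And>k m A. A \<in> sets M \<Longrightarrow> A \<subseteq> cell k \<Longrightarrow>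
      emeasure M (F m ` A) * emeasure M (cell k) \<le> ennreal K * (emeasure M (cell (k + m)) * emeasure M A)"
    by (rule cell_distortion) blast
  show thesis
  proof
    fix k m and u :: "'a \<Rightarrow> ennreal" assume u: "u \<in> borel_measurable M"
    define a where "a = emeasure M (cell k)"
    have a: "a \<noteq> 0" "a \<noteq> top"
      using emeasure_cell_pos[of k] emeasure_cell_finite[of k] by (auto simp: a_def)
    \<comment> \<open>The factor by which \<open>F m\<close> can enlarge subsets of
      \<open>cell k\<close>. To apply the transport lemma to \<open>F (- m)\<close>, the integrand
      \<open>u\<close> is written as \<open>u (F m (F (- m) x))\<close>.\<close>
    define r where "r = ennreal K * emeasure M (cell (k + m)) / a"
    have "(\<integral>\<^sup>+x. indicator (cell (k + m)) x * u (F m (F (- m) x)) \<partial>M)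
        \<le> r * (\<integral>\<^sup>+x. indicator (cell k) x * u (F m x) \<partial>M)"
    proof (rule nn_integral_transport_le[OF F_measurable cell_sets cell_sets, where u = "\<lambda>x. u (F m x)"])
      show "(\<lambda>x. u (F m x)) \<in> borel_measurable M"
        using F_measurable u by measurable
      fix A assume A: "A \<in> sets M"
      have "F (- m) -` A \<inter> space M \<inter> cell (k + m) = F m ` A \<inter> F m ` cell k"
        using sets.sets_into_space[OF A] by (simp add: F_vimage F_image_cell)
      also have "\<dots> \<subseteq> F m ` (A \<inter> cell k)"
        using sets.sets_into_space[OF A] cell_subset[of k]
        by (auto simp: subset_iff) (metis F_inverse(1) IntI image_eqI)
      finally have "emeasure M (F (- m) -` A \<inter> space M \<inter> cell (k + m)) \<le> emeasure M (F m ` (A \<inter> cell k))"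
        using A cell_sets F_image_sets by (intro emeasure_mono) auto
      also have "\<dots> = emeasure M (F m ` (A \<inter> cell k)) * a / a"
        using a by (simp add: ennreal_mult_divide_eq)
      also have "\<dots> \<le> ennreal K * (emeasure M (cell (k + m)) * emeasure M (A \<inter> cell k)) / a"
        unfolding a_def using A cell_sets by (intro divide_right_mono_ennreal dist) auto
      also have "\<dots> = r * emeasure M (A \<inter> cell k)"
        by (simp add: r_def divide_ennreal_def mult_ac)
      finally show "emeasure M (F (- m) -` A \<inter> space M \<inter> cell (k + m)) \<le> r * emeasure M (A \<inter> cell k)" .
    qed
    also have "(\<integral>\<^sup>+x. indicator (cell (k + m)) x * u (F m (F (- m) x)) \<partial>M)
        = (\<integral>\<^sup>+x. indicator (cell (k + m)) x * u x \<partial>M)"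
      by (intro nn_integral_cong) (simp add: F_inverse)
    finally have "(\<integral>\<^sup>+x. indicator (cell (k + m)) x * u x \<partial>M) * a
        \<le> r * (\<integral>\<^sup>+x. indicator (cell k) x * u (F m x) \<partial>M) * a"
      by (rule mult_right_mono) simp
    also have "\<dots> = (r * a) * (\<integral>\<^sup>+x. indicator (cell k) x * u (F m x) \<partial>M)"
      by (simp add: mult_ac)
    also have "r * a = ennreal K * emeasure M (cell (k + m))"
      using a by (simp add: r_def ennreal_divide_times top.not_eq_extremum)
    finally show "(\<integral>\<^sup>+x. indicator (cell (k + m)) x * u x \<partial>M) * emeasure M (cell k)
        \<le> ennreal K * emeasure M (cell (k + m)) * (\<integral>\<^sup>+x. indicator (cell k) x * u (F m x) \<partial>M)"
      by (simp add: a_def)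
  qed (rule K)
qed

text \<open>Lets an estimate for subsets of a single cell be summed to all measurable sets; the case
  \<open>m = 0\<close> decomposes \<open>A\<close> itself.\<close>

lemma countable_cell_decomposition:
  assumes A: "A \<in> sets M"
  shows "emeasure M (F m ` A) = (\<integral>\<^sup>+k. emeasure M (F m ` (A \<inter> cell k)) \<partial>count_space UNIV)"
proof -
  have "space M = (\<Union>k. cell k)"
    using W_generates by (simp add: cell_def)
  then have "A = (\<Union>k. A \<inter> cell k)"
    using sets.sets_into_space[OF A] by blast
  then have "F m ` A = F m ` (\<Union>k. A \<inter> cell k)"
    by (rule arg_cong)
  then have "F m ` A = (\<Union>k. F m ` (A \<inter> cell k))"
    by (simp only: image_UN)
  moreover have "disjoint_family (\<lambda>k. F m ` (A \<inter> cell k))"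
  proof (rule disjoint_family_on_bisimulation[of "\<lambda>k. cell (k + m)"])
    show "disjoint_family (\<lambda>k. cell (k + m))"
      using cell_unique by (force simp: disjoint_family_on_def)
    show "F m ` (A \<inter> cell i) \<inter> F m ` (A \<inter> cell j) = {}" if "cell (i + m) \<inter> cell (j + m) = {}" for i j
      using that F_image_cell[of m i] F_image_cell[of m j] by blast
  qed
  ultimately show ?thesis
    using A cell_sets F_image_sets by (simp add: emeasure_UN_countable)
qed

section \<open>From bounded tails to uniform contraction\<close>

text \<open>Each of the \<open>N\<close> cells after \<open>cell k\<close> has at least
  \<open>1 / D\<close> times the measure of the last one, while together they have at most
  \<open>D\<close> times that of \<open>cell k\<close>. So the last one is small relative to
  \<open>cell k\<close> for large \<open>N\<close>, and distortion passes this on to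
  subsets.\<close>

lemma uniform_contraction:
  assumes D: "1 \<le> D"
    and tail: "\<And>k n. (\<Sum>j=1..n. emeasure M (cell (k + int j))) \<le> ennreal D * emeasure M (cell k)"
    and \<theta>: "0 < \<theta>"
  obtains N :: nat where "0 < N"
    "\<And>A. A \<in> sets M \<Longrightarrow> emeasure M (F (int N) ` A) \<le> ennreal \<theta> * emeasure M A"
proof -
  obtain K :: real where K: "0 < K"
    and dist: "\<And>k m A. A \<in> sets M \<Longrightarrow> A \<subseteq> cell k \<Longrightarrow>
      emeasure M (F m ` A) * emeasure M (cell k) \<le> ennreal K * (emeasure M (cell (k + m)) * emeasure M A)"
    by (rule cell_distortion) blast
  \<comment> \<open>Distortion and decay multiply to \<open>K * D^2 / N\<close>, which has to be at
    most \<open>\<theta>\<close>.\<close>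
  obtain N0 :: nat where N0: "K * D\<^sup>2 / \<theta> \<le> real N0"
    using real_arch_simple by blast
  define N where "N = Suc N0"
  have N: "K * D\<^sup>2 \<le> \<theta> * real N"
    using N0 \<theta> by (simp add: N_def field_simps)
  \<comment> \<open>For \<open>j = N\<close> there is no later cell to bound, and
    \<open>1 <= D\<close> is used instead of \<open>tail\<close>.\<close>
  have later: "emeasure M (cell (k + int N)) \<le> ennreal D * emeasure M (cell (k + int j))"
    if j: "j \<in> {1..N}" for k j
  proof (cases "j = N")
    case True
    have "1 * emeasure M (cell (k + int N)) \<le> ennreal D * emeasure M (cell (k + int N))"
      using D by (intro mult_right_mono) (auto simp: ennreal_1[symmetric] simp del: ennreal_1 intro: ennreal_leI)
    then show ?thesis
      using True by simp
  next
    case False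
    then have "emeasure M (cell (k + int j + int (N - j)))
        \<le> (\<Sum>i=1..N - j. emeasure M (cell (k + int j + int i)))"
      using j by (intro member_le_sum) auto
    also have "\<dots> \<le> ennreal D * emeasure M (cell (k + int j))"
      by (rule tail)
    finally show ?thesis
      using j by (simp add: of_nat_diff)
  qed
  have decay: "ennreal (real N) * emeasure M (cell (k + int N)) \<le> ennreal (D\<^sup>2) * emeasure M (cell k)" for k
  proof -
    have "ennreal (real N) * emeasure M (cell (k + int N)) = (\<Sum>j=1..N. emeasure M (cell (k + int N)))"
      by (simp add: ennreal_of_nat_eq_real_of_nat)
    also have "\<dots> \<le> (\<Sum>j=1..N. ennreal D * emeasure M (cell (k + int j)))"
      by (intro sum_mono later)
    also have "\<dots> = ennreal D * (\<Sum>j=1..N. emeasure M (cell (k + int j)))"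
      by (simp add: sum_distrib_left)
    also have "\<dots> \<le> ennreal D * (ennreal D * emeasure M (cell k))"
      by (intro mult_left_mono tail) simp
    also have "\<dots> = ennreal (D\<^sup>2) * emeasure M (cell k)"
      using D by (simp add: power2_eq_square ennreal_mult mult.assoc)
    finally show ?thesis .
  qed
  have on_cell: "emeasure M (F (int N) ` A) \<le> ennreal \<theta> * emeasure M A"
    if A: "A \<in> sets M" "A \<subseteq> cell k" for A k
  proof -
    define c where "c = ennreal (real N) * emeasure M (cell k)"
    have c: "c \<noteq> 0" "c \<noteq> top"
      using emeasure_cell_pos[of k] emeasure_cell_finite[of k]
      by (auto simp: c_def N_def ennreal_mult_eq_top_iff)
    have "c * emeasure M (F (int N) ` A) = ennreal (real N) * (emeasure M (F (int N) ` A) * emeasure M (cell k))"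
      by (simp add: c_def mult_ac)
    also have "\<dots> \<le> ennreal (real N) * (ennreal K * (emeasure M (cell (k + int N)) * emeasure M A))"
      using dist[OF A] by (intro mult_left_mono) auto
    also have "\<dots> = ennreal K * emeasure M A * (ennreal (real N) * emeasure M (cell (k + int N)))"
      by (simp add: mult_ac)
    also have "\<dots> \<le> ennreal K * emeasure M A * (ennreal (D\<^sup>2) * emeasure M (cell k))"
      by (intro mult_left_mono decay) simp
    also have "\<dots> = ennreal (K * D\<^sup>2) * (emeasure M (cell k) * emeasure M A)"
      using K by (simp add: ennreal_mult mult_ac)
    also have "\<dots> \<le> ennreal (\<theta> * real N) * (emeasure M (cell k) * emeasure M A)"
      using N by (intro mult_right_mono ennreal_leI) auto
    also have "\<dots> = c * (ennreal \<theta> * emeasure M A)"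
      using \<theta> by (simp add: c_def ennreal_mult mult_ac)
    finally show ?thesis
      using c by (simp add: ennreal_mult_le_mult_iff)
  qed
  show thesis
  proof
    show "0 < N" by (simp add: N_def)
    fix A assume A: "A \<in> sets M"
    have "emeasure M (F (int N) ` A) \<le> (\<integral>\<^sup>+k. ennreal \<theta> * emeasure M (F 0 ` (A \<inter> cell k)) \<partial>count_space UNIV)"
      unfolding countable_cell_decomposition[OF A, of "int N"]
      using A cell_sets by (intro nn_integral_mono) (auto simp: F_image_0 intro!: on_cell)
    also have "\<dots> = ennreal \<theta> * emeasure M (F 0 ` A)"
      unfolding countable_cell_decomposition[OF A, of 0] by (simp add: nn_integral_cmult)
    finally show "emeasure M (F (int N) ` A) \<le> ennreal \<theta> * emeasure M A"
      by (simp add: F_image_0)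
  qed
qed

text \<open>
  On \<open>cell (- i)\<close> with \<open>i\<close> large, \<open>g \<circ> F (l + i)\<close> is compared with the constant \<open>s\<close>;
  since the cells \<open>cell (- i)\<close> are arbitrarily large, distortion leaves \<open>g\<close> no room to
  differ from \<open>s\<close> on \<open>cell l\<close>.
\<close>

lemma eq_const_on_later_cells:
  assumes unbounded: "(SUP n\<in>{1::nat..}. emeasure M (cell (- int n))) = \<infinity>"
    and g: "g \<in> borel_measurable M"
    and bound: "\<And>n. pmass (\<lambda>x. g (F (int n) x) - (\<Sum>j<n. s * indicator (cell k) (F (int j) x))) \<le> 1"
    and l: "k < l"
  shows "AE x in M. x \<in> cell l \<longrightarrow> g x = s"
proof -
  obtain K :: real where K: "0 < K"
    and dist: "\<And>k m u. u \<in> borel_measurable M \<Longrightarrow>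
      (\<integral>\<^sup>+x. indicator (cell (k + m)) x * u x \<partial>M) * emeasure M (cell k)
        \<le> ennreal K * emeasure M (cell (k + m)) * (\<integral>\<^sup>+x. indicator (cell k) x * u (F m x) \<partial>M)"
    by (rule nn_integral_cell_distortion) blast
  define u where "u x = ennreal (norm (g x - s) powr p)" for x
  have [measurable]: "u \<in> borel_measurable M"
    unfolding u_def using g by measurable
  define I where "I = (\<integral>\<^sup>+x. indicator (cell l) x * u x \<partial>M)"
  \<comment> \<open>The threshold on \<open>i\<close> makes both \<open>l + int i\<close> and
    \<open>k + int i\<close> nonnegative.\<close>
  have far: "I * emeasure M (cell (- int i)) \<le> ennreal K * emeasure M (cell l)"
    if i: "i \<ge> nat (- k) + nat (- l)" for i
  proof -
    \<comment> \<open>The number of steps leading from \<open>cell (- int i)\<close> to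
      \<open>cell l\<close>.\<close>
    define m where "m = nat (l + int i)"
    have m: "- int i + int m = l" "0 \<le> k + int i" "k + int i < int m"
      using i l by (auto simp: m_def)
    have "(\<integral>\<^sup>+x. indicator (cell (- int i)) x * u (F (int m) x) \<partial>M)
        \<le> pmass (\<lambda>x. g (F (int m) x) - (\<Sum>j<m. s * indicator (cell k) (F (int j) x)))"
      unfolding pmass_def
    proof (rule nn_integral_mono)
      fix x
      \<comment> \<open>An orbit starting in \<open>cell (- int i)\<close> visits
        \<open>cell k\<close> exactly once, at time \<open>k + int i\<close>. This is before time
        \<open>m\<close> because \<open>k < l\<close>, so the whole sum equals
        \<open>s\<close>.\<close>
      have "(\<Sum>j<m. s * indicator (cell k) (F (int j) x)) = s" if "x \<in> cell (- int i)"
      proof -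
        have "(\<Sum>j<m. s * indicator (cell k) (F (int j) x)) = (\<Sum>j<m. if j = nat (k + int i) then s else 0)"
          using F_mem_cell_iff[OF that] m(2) by (intro sum.cong) (auto simp: indicator_def)
        then show ?thesis
          using m(2,3) by (simp add: nat_less_iff)
      qed
      then show "indicator (cell (- int i)) x * u (F (int m) x)
          \<le> ennreal (norm (g (F (int m) x) - (\<Sum>j<m. s * indicator (cell k) (F (int j) x))) powr p)"
        by (auto simp: indicator_def u_def)
    qed
    also have "\<dots> \<le> 1"
      by (rule bound)
    finally have "ennreal K * emeasure M (cell l) * (\<integral>\<^sup>+x. indicator (cell (- int i)) x * u (F (int m) x) \<partial>M)
        \<le> ennreal K * emeasure M (cell l) * 1"
      by (rule mult_left_mono) simp
    with dist[of u "- int i" "int m"] show ?thesis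
      unfolding m(1) I_def by simp
  qed
  have "I = 0"
  proof (rule ccontr)
    assume I: "I \<noteq> 0"
    define i0 where "i0 = nat (- k) + nat (- l)"
    \<comment> \<open>A finite bound for all cells \<open>cell (- int i)\<close>, contradicting
      unboundedness: the first \<open>i0\<close> of them are bounded by their sum, the others by
      \<open>far\<close>.\<close>
    define B where "B = (\<Sum>i<i0. emeasure M (cell (- int i))) + ennreal K * emeasure M (cell l) / I"
    have "emeasure M (cell (- int i)) \<le> B" for i
    proof (cases "i < i0")
      case True
      then have "emeasure M (cell (- int i)) \<le> (\<Sum>i<i0. emeasure M (cell (- int i)))"
        by (intro member_le_sum) auto
      then show ?thesis
        unfolding B_def by (rule order_trans) simp
    next
      case False
      have fin: "ennreal K * emeasure M (cell l) < top"
        using emeasure_cell_finite by (simp add: ennreal_mult_less_top)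
      have "I * emeasure M (cell (- int i0)) \<le> ennreal K * emeasure M (cell l)"
        by (rule far) (simp add: i0_def)
      then have "I \<noteq> top"
        using fin emeasure_cell_pos[of "- int i0"]
        by (auto simp: ennreal_top_mult top_unique zero_less_iff_neq_zero)
      then have "emeasure M (cell (- int i)) = emeasure M (cell (- int i)) * I / I"
        using I by (simp add: ennreal_mult_divide_eq)
      also have "\<dots> = I * emeasure M (cell (- int i)) / I"
        by (simp only: mult.commute)
      also have "\<dots> \<le> ennreal K * emeasure M (cell l) / I"
        using far[of i] False by (intro divide_right_mono_ennreal) (simp add: i0_def)
      finally show ?thesis
        unfolding B_def by (rule order_trans) simp
    qed
    then have "(\<infinity>::ennreal) \<le> B"
      unfolding unbounded[symmetric] by (intro SUP_least)
    moreover have "B < top"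
      unfolding B_def using I emeasure_cell_finite
      by (auto simp: ennreal_divide_eq_top_iff ennreal_mult_eq_top_iff top.not_eq_extremum[symmetric])
    ultimately show False
      by simp
  qed
  then have "AE x in M. indicator (cell l) x * u x = 0"
    unfolding I_def using cell_sets by (subst (asm) nn_integral_0_iff_AE) auto
  then show ?thesis
    by eventually_elim (auto simp: u_def indicator_def split: if_splits)
qed

text \<open>The later cells are disjoint and each contributes \<open>norm s powr p\<close> times its
  measure to \<open>pmass g\<close>.\<close>

lemma tail_le_of_eq_const:
  assumes g: "pmass g \<le> 1"
    and const: "\<And>l. k < l \<Longrightarrow> AE x in M. x \<in> cell l \<longrightarrow> g x = s"
  shows "ennreal (norm s powr p) * (\<Sum>j=1..n. emeasure M (cell (k + int j))) \<le> 1"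
proof -
  let ?A = "\<Union>j\<in>{1..n}. cell (k + int j)"
  have disj: "disjoint_family_on (\<lambda>j. cell (k + int j)) {1..n}"
    using cell_unique by (force simp: disjoint_family_on_def)
  have "(\<Sum>j=1..n. emeasure M (cell (k + int j))) = emeasure M ?A"
    using cell_sets disj by (intro sum_emeasure) auto
  then have "ennreal (norm s powr p) * (\<Sum>j=1..n. emeasure M (cell (k + int j)))
      = (\<integral>\<^sup>+x. ennreal (norm s powr p) * indicator ?A x \<partial>M)"
    using cell_sets by (simp add: nn_integral_cmult_indicator)
  also have "\<dots> \<le> pmass g"
    unfolding pmass_def
  proof (rule nn_integral_mono_AE)
    have "AE x in M. \<forall>j\<in>{1..n}. x \<in> cell (k + int j) \<longrightarrow> g x = s"
      using const by (intro AE_finite_allI) auto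
    then show "AE x in M. ennreal (norm s powr p) * indicator ?A x \<le> ennreal (norm (g x) powr p)"
      by eventually_elim (auto simp: indicator_def)
  qed
  finally show ?thesis
    using g by (rule order_trans)
qed

end

section \<open>The composition operator\<close>

context invertible_dissipative_system
begin

lemma nn_integral_F_le:
  assumes le: "\<And>A. A \<in> sets M \<Longrightarrow> emeasure M (F (- k) ` A) \<le> r * emeasure M A"
    and u: "u \<in> borel_measurable M"
  shows "(\<integral>\<^sup>+x. u (F k x) \<partial>M) \<le> r * (\<integral>\<^sup>+x. u x \<partial>M)"
proof -
  have "(\<integral>\<^sup>+x. indicator (space M) x * u (F k x) \<partial>M) \<le> r * (\<integral>\<^sup>+x. indicator (space M) x * u x \<partial>M)"
  proof (rule nn_integral_transport_le[OF F_measurable sets.top sets.top _ u])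
    fix A assume A: "A \<in> sets M"
    then show "emeasure M (F k -` A \<inter> space M \<inter> space M) \<le> r * emeasure M (A \<inter> space M)"
      using le[OF A] sets.sets_into_space[OF A] sets.sets_into_space[OF F_image_sets[OF A, of "- k"]]
      by (simp add: F_vimage Int_absorb2)
  qed
  moreover have "(\<integral>\<^sup>+x. indicator (space M) x * v x \<partial>M) = (\<integral>\<^sup>+x. v x \<partial>M)" for v :: "'a \<Rightarrow> ennreal"
    by (intro nn_integral_cong) simp
  ultimately show ?thesis
    by simp
qed

lemma pmass_F_le:
  assumes "\<And>A. A \<in> sets M \<Longrightarrow> emeasure M (F (- k) ` A) \<le> ennreal r * emeasure M A"
    and g: "g \<in> borel_measurable M"
  shows "pmass (\<lambda>x. g (F k x)) \<le> ennreal r * pmass g"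
proof -
  have "(\<lambda>x. ennreal (norm (g x) powr p)) \<in> borel_measurable M"
    using g by measurable
  with assms(1) show ?thesis
    unfolding pmass_def by (rule nn_integral_F_le)
qed

lemma Lp_funs_F:
  assumes g: "g \<in> Lp_funs p M"
  shows "(\<lambda>x. g (F k x)) \<in> Lp_funs p M"
proof -
  have [measurable]: "g \<in> borel_measurable M" "F k \<in> measurable M M"
    using g by (auto simp: Lp_funs_measurable F_measurable)
  obtain c :: real where "\<And>A. A \<in> sets M \<Longrightarrow> emeasure M (F (- k) ` A) \<le> ennreal c * emeasure M A"
    using F_bound[of "- k"] by blast
  then have "pmass (\<lambda>x. g (F k x)) \<le> ennreal c * pmass g"
    using Lp_funs_measurable[OF g] by (rule pmass_F_le)
  also have "\<dots> < \<infinity>"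
    using g by (simp add: Lp_funs_iff ennreal_mult_less_top)
  finally show ?thesis
    by (simp add: Lp_funs_iff)
qed

lemma Lnorm_F_le:
  assumes le: "\<And>A. A \<in> sets M \<Longrightarrow> emeasure M (F (- k) ` A) \<le> ennreal r * emeasure M A"
    and r: "0 \<le> r" and g: "g \<in> Lp_funs p M"
  shows "Lnorm (\<lambda>x. g (F k x)) \<le> r powr (1 / p) * Lnorm g"
proof (subst Lnorm_le_iff[OF Lp_funs_F[OF g]])
  show "0 \<le> r powr (1 / p) * Lnorm g"
    using Lnorm_nonneg by simp
  have "pmass (\<lambda>x. g (F k x)) \<le> ennreal r * pmass g"
    using le Lp_funs_measurable[OF g] by (rule pmass_F_le)
  also have "\<dots> = ennreal r * ennreal (Lnorm g powr p)"
    by (simp add: Lnorm_powr[OF g])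
  also have "\<dots> = ennreal ((r powr (1 / p) * Lnorm g) powr p)"
    using r exponent Lnorm_nonneg[of g] by (simp add: powr_mult powr_powr ennreal_mult)
  finally show "pmass (\<lambda>x. g (F k x)) \<le> ennreal ((r powr (1 / p) * Lnorm g) powr p)" .
qed

lemma AE_F: "AE x in M. P x \<Longrightarrow> AE x in M. P (F k x)"
proof -
  assume P: "AE x in M. P x"
  obtain c :: real where "\<And>A. A \<in> sets M \<Longrightarrow> emeasure M (F (- k) ` A) \<le> ennreal c * emeasure M A"
    using F_bound[of "- k"] by blast
  then show ?thesis
    using P by (intro AE_transport[OF F_measurable, of k "ennreal c"])
      (simp_all add: F_vimage sets.sets_into_space)
qed

lemma comp_op_F:
  assumes g: "g \<in> Lp_funs p M"
  shows "comp_op p M (F k) (Lp_class p M g) = Lp_class p M (\<lambda>x. g (F k x))"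
  unfolding comp_op_def comp_def
proof (rule UN_Lp_class[of g "\<lambda>g. Lp_class p M (\<lambda>x. g (F k x))", OF g])
  fix h assume "h \<in> Lp_funs p M" "AE x in M. g x = h x"
  then show "Lp_class p M (\<lambda>x. h (F k x)) = Lp_class p M (\<lambda>x. g (F k x))"
    using g Lp_funs_F AE_F[of "\<lambda>x. g x = h x"] by (intro Lp_class_eqI)
qed

lemma comp_op_f:
  assumes "g \<in> Lp_funs p M"
  shows "comp_op p M f (Lp_class p M g) = Lp_class p M (\<lambda>x. g (f x))"
  using comp_op_F[OF assms, of 1] by (simp add: F_1)

lemma Lp_class_cong:
  assumes "g \<in> Lp_funs p M" "h \<in> Lp_funs p M" "\<And>x. x \<in> space M \<Longrightarrow> g x = h x"
  shows "Lp_class p M g = Lp_class p M h"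
  using assms by (simp add: Lp_class_eq_iff AE_I2)

lemma comp_op_F_F:
  assumes g: "g \<in> Lp_funs p M"
  shows "comp_op p M (F j) (comp_op p M (F k) (Lp_class p M g)) = Lp_class p M (\<lambda>x. g (F (k + j) x))"
proof -
  have "comp_op p M (F j) (comp_op p M (F k) (Lp_class p M g)) = Lp_class p M (\<lambda>x. g (F k (F j x)))"
    by (simp add: comp_op_F g Lp_funs_F)
  also have "\<dots> = Lp_class p M (\<lambda>x. g (F (k + j) x))"
  proof (rule Lp_class_cong)
    show "(\<lambda>x. g (F k (F j x))) \<in> Lp_funs p M"
      using Lp_funs_F[OF Lp_funs_F[OF g, of k], of j] .
  qed (simp_all add: Lp_funs_F g F_add)
  finally show ?thesis .
qed

lemma comp_op_bij: "bij_betw (comp_op p M f) (points (Lp p M)) (points (Lp p M))"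
proof (rule bij_betw_byWitness[where f' = "comp_op p M (F (- 1))"])
  have *: "comp_op p M (F (- k)) (comp_op p M (F k) G) = G" "comp_op p M (F k) G \<in> points (Lp p M)"
    if G: "G \<in> points (Lp p M)" for G k
  proof -
    obtain g where g: "g \<in> Lp_funs p M" "G = Lp_class p M g"
      using G by (rule Lp_pointE)
    show "comp_op p M (F (- k)) (comp_op p M (F k) G) = G"
      using g by (simp add: comp_op_F_F F_0)
    show "comp_op p M (F k) G \<in> points (Lp p M)"
      using g by (simp add: comp_op_F Lp_funs_F Lp_class_in_points)
  qed
  show "\<forall>G\<in>points (Lp p M). comp_op p M (F (- 1)) (comp_op p M f G) = G"
    using *(1)[of _ 1] by (simp add: F_1)
  show "\<forall>G\<in>points (Lp p M). comp_op p M f (comp_op p M (F (- 1)) G) = G"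
    using *(1)[of _ "- 1"] by (simp add: F_1)
  show "comp_op p M f ` points (Lp p M) \<subseteq> points (Lp p M)"
    using *(2)[of _ 1] by (auto simp: F_1)
  show "comp_op p M (F (- 1)) ` points (Lp p M) \<subseteq> points (Lp p M)"
    using *(2) by auto
qed

lemma inv_comp_op:
  assumes g: "g \<in> Lp_funs p M"
  shows "inv_into (points (Lp p M)) (comp_op p M f) (Lp_class p M g) = Lp_class p M (\<lambda>x. g (F (- 1) x))"
proof (rule inv_into_f_eq)
  show "inj_on (comp_op p M f) (points (Lp p M))"
    using comp_op_bij by (rule bij_betw_imp_inj_on)
  show "Lp_class p M (\<lambda>x. g (F (- 1) x)) \<in> points (Lp p M)"
    using g by (intro Lp_class_in_points Lp_funs_F)
  show "comp_op p M f (Lp_class p M (\<lambda>x. g (F (- 1) x))) = Lp_class p M g"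
    using comp_op_F_F[OF g, of 1 "- 1"] g by (simp add: comp_op_F F_1 F_0)
qed

lemma comp_op_iter:
  assumes g: "g \<in> Lp_funs p M"
  shows "(comp_op p M f ^^ n) (Lp_class p M g) = Lp_class p M (\<lambda>x. g (F (int n) x))"
proof (induction n)
  case 0
  then show ?case by (simp add: F_0)
next
  case (Suc n)
  then show ?case
    using comp_op_F_F[OF g, of 1 "int n"] g by (simp add: comp_op_F F_1 add.commute)
qed

lemma inv_comp_op_iter:
  assumes g: "g \<in> Lp_funs p M"
  shows "(inv_into (points (Lp p M)) (comp_op p M f) ^^ n) (Lp_class p M g) = Lp_class p M (\<lambda>x. g (F (- int n) x))"
proof (induction n)
  case 0
  then show ?case by (simp add: F_0)
next
  case (Suc n)
  have "(inv_into (points (Lp p M)) (comp_op p M f) ^^ Suc n) (Lp_class p M g)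
      = Lp_class p M (\<lambda>x. g (F (- int n) (F (- 1) x)))"
    using Suc g by (simp add: inv_comp_op Lp_funs_F)
  also have "\<dots> = Lp_class p M (\<lambda>x. g (F (- int (Suc n)) x))"
  proof (rule Lp_class_cong)
    show "(\<lambda>x. g (F (- int n) (F (- 1) x))) \<in> Lp_funs p M"
      using Lp_funs_F[OF Lp_funs_F[OF g, of "- int n"], of "- 1"] .
    show "g (F (- int n) (F (- 1) x)) = g (F (- int (Suc n)) x)" if "x \<in> space M" for x
    proof -
      have "- int (Suc n) = - int n + - 1"
        by simp
      then show ?thesis
        by (simp only: F_add[OF that])
    qed
  qed (intro Lp_funs_F g)
  finally show ?case .
qed

lemma vdist_F_le:
  assumes le: "\<And>A. A \<in> sets M \<Longrightarrow> emeasure M (F (- k) ` A) \<le> ennreal r * emeasure M A"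
    and r: "0 \<le> r" and g: "g \<in> Lp_funs p M" and h: "h \<in> Lp_funs p M"
  shows "vdist (Lp p M) (Lp_class p M (\<lambda>x. g (F k x))) (Lp_class p M (\<lambda>x. h (F k x)))
    \<le> r powr (1 / p) * vdist (Lp p M) (Lp_class p M g) (Lp_class p M h)"
  using Lnorm_F_le[OF le r Lp_funs_diff[OF g h]] by (simp add: vdist_Lp g h Lp_funs_F)

text \<open>Measure bounds for images under \<open>F\<close> become Lipschitz bounds for the
  operator and its inverse after taking \<open>p\<close>-th roots.\<close>

lemma expanding_operator_comp_op:
  assumes D: "1 \<le> D"
    and tail: "\<And>k n. (\<Sum>j=1..n. emeasure M (cell (k + int j))) \<le> ennreal D * emeasure M (cell k)"
  shows "\<exists>L c N. expanding_operator (Lp p M) (comp_op p M f) L c N"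
proof -
  let ?U = "inv_into (points (Lp p M)) (comp_op p M f)"
  obtain L where L: "0 \<le> L" "\<And>A. A \<in> sets M \<Longrightarrow> emeasure M (F (- 1) ` A) \<le> ennreal L * emeasure M A"
    using F_bound[of "- 1"] by blast
  obtain c where c: "0 \<le> c" "\<And>A. A \<in> sets M \<Longrightarrow> emeasure M (F (- (- 1)) ` A) \<le> ennreal c * emeasure M A"
    using F_bound[of "- (- 1)"] by blast
  \<comment> \<open>The factor \<open>(1 / 2) powr p\<close> has \<open>p\<close>-th root
    \<open>1 / 2\<close>. The double negation matches \<open>vdist_F_le\<close> at
    \<open>k = - int N\<close>.\<close>
  obtain N where N: "0 < N"
    "\<And>A. A \<in> sets M \<Longrightarrow> emeasure M (F (- (- int N)) ` A) \<le> ennreal ((1 / 2) powr p) * emeasure M A"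
    by (rule uniform_contraction[OF D tail, of "(1 / 2) powr p"]) auto
  interpret complete_nspace "Lp p M"
    by (rule complete_nspace_Lp)
  have "expanding_operator (Lp p M) (comp_op p M f) (L powr (1 / p)) (c powr (1 / p)) N"
  proof
    fix G H assume "G \<in> points (Lp p M)" "H \<in> points (Lp p M)"
    then obtain g h where gh: "g \<in> Lp_funs p M" "G = Lp_class p M g" "h \<in> Lp_funs p M" "H = Lp_class p M h"
      by (metis Lp_pointE)
    show "comp_op p M f (vadd (Lp p M) G H) = vadd (Lp p M) (comp_op p M f G) (comp_op p M f H)"
      using gh Lp_funs_F[of _ 1] by (simp add: vadd_Lp comp_op_f Lp_funs_add F_1)
    show "vdist (Lp p M) (comp_op p M f G) (comp_op p M f H) \<le> L powr (1 / p) * vdist (Lp p M) G H"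
      using vdist_F_le[OF L(2,1) gh(1,3)] gh by (simp add: comp_op_f F_1)
    show "vdist (Lp p M) (?U G) (?U H) \<le> c powr (1 / p) * vdist (Lp p M) G H"
      using vdist_F_le[OF c(2,1) gh(1,3)] gh by (simp add: inv_comp_op)
    show "vdist (Lp p M) ((?U ^^ N) G) ((?U ^^ N) H) \<le> vdist (Lp p M) G H / 2"
      using vdist_F_le[OF N(2) _ gh(1,3)] gh exponent by (simp add: inv_comp_op_iter powr_powr)
  qed (use comp_op_bij N in auto)
  then show ?thesis
    by blast
qed

section \<open>Bounded orbits for perturbations supported on one cell\<close>

text \<open>The indicator of \<open>cell k\<close> scaled to norm \<open>r\<close>, so that the size
  of the perturbation does not depend on \<open>k\<close>.\<close>

definition bump :: "real \<Rightarrow> int \<Rightarrow> 'a \<Rightarrow> complex" where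
  "bump r k x = of_real (r / measure M (cell k) powr (1 / p)) * indicator (cell k) x"

lemma measure_cell_pos: "0 < measure M (cell k)"
  and emeasure_cell: "emeasure M (cell k) = ennreal (measure M (cell k))"
  using emeasure_cell_pos[of k] emeasure_cell_finite[of k]
  by (auto simp: measure_def enn2real_positive_iff)

lemma bump_Lp:
  assumes r: "0 \<le> r"
  shows "bump r k \<in> Lp_funs p M" "Lnorm (bump r k) \<le> r"
proof -
  let ?c = "r / measure M (cell k) powr (1 / p)"
  have "pmass (bump r k) = (\<integral>\<^sup>+x. ennreal (?c powr p) * indicator (cell k) x \<partial>M)"
    unfolding pmass_def bump_def using r exponent
    by (intro nn_integral_cong) (auto simp: indicator_def norm_divide)
  also have "\<dots> = ennreal (?c powr p) * emeasure M (cell k)"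
    using cell_sets by (simp add: nn_integral_cmult_indicator)
  also have "\<dots> = ennreal (r powr p)"
    using measure_cell_pos[of k] r exponent
    by (simp add: emeasure_cell powr_divide powr_powr flip: ennreal_mult)
  finally have mass: "pmass (bump r k) = ennreal (r powr p)" .
  have "bump r k \<in> borel_measurable M"
    unfolding bump_def[abs_def] using cell_sets by measurable
  then show "bump r k \<in> Lp_funs p M"
    by (simp add: Lp_funs_iff mass)
  then show "Lnorm (bump r k) \<le> r"
    using r by (simp add: Lnorm_le_iff mass)
qed

text \<open>A representative of \<open>z + T z + ... + T^(n-1) z\<close> for
  \<open>z = bump r k\<close>.\<close>

definition orbit_sum :: "real \<Rightarrow> int \<Rightarrow> nat \<Rightarrow> 'a \<Rightarrow> complex" where
  "orbit_sum r k n x = (\<Sum>j<n. bump r k (F (int j) x))"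

lemma orbit_sum_Lp: "0 \<le> r \<Longrightarrow> orbit_sum r k n \<in> Lp_funs p M"
proof (induction n)
  case 0
  then show ?case
    using exponent by (simp add: orbit_sum_def[abs_def] Lp_funs_iff pmass_def)
next
  case (Suc n)
  then show ?case
    using Lp_funs_add[OF Suc.IH Lp_funs_F[OF bump_Lp(1)]] by (simp add: orbit_sum_def[abs_def])
qed

text \<open>On the later cells \<open>g\<close> equals the height \<open>s\<close> of the bump, and
  \<open>norm s powr p\<close> is \<open>r powr p\<close> divided by the measure of
  \<open>cell k\<close>. The bound on \<open>pmass g\<close> therefore gives a tail constant that is
  the same for all \<open>k\<close>.\<close>

lemma expanding_if_bounded_orbits:
  assumes unbounded: "(SUP n\<in>{1::nat..}. emeasure M (cell (- int n))) = \<infinity>"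
    and r: "0 < r"
    and orbits: "\<And>k. \<exists>g\<in>Lp_funs p M. \<forall>n. Lnorm (\<lambda>x. g (F (int n) x) - orbit_sum r k n x) \<le> 1"
  shows "\<exists>L c N. expanding_operator (Lp p M) (comp_op p M f) L c N"
proof (rule expanding_operator_comp_op)
  \<comment> \<open>The maximum with \<open>1\<close> meets the requirement
    \<open>1 <= D\<close>.\<close>
  let ?D = "max 1 (1 / r powr p)"
  show "1 \<le> ?D" by simp
  fix k n
  obtain g where g: "g \<in> Lp_funs p M" "\<And>n. Lnorm (\<lambda>x. g (F (int n) x) - orbit_sum r k n x) \<le> 1"
    using orbits by blast
  define a where "a = measure M (cell k)"
  have a: "0 < a" "emeasure M (cell k) = ennreal a"
    using measure_cell_pos emeasure_cell by (simp_all add: a_def)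
  define s :: complex where "s = of_real (r / a powr (1 / p))"
  have s: "norm s powr p = r powr p / a"
    using r a exponent by (simp add: s_def norm_divide powr_divide powr_powr)
  have bound: "pmass (\<lambda>x. g (F (int n) x) - (\<Sum>j<n. s * indicator (cell k) (F (int j) x))) \<le> 1" for n
  proof -
    have "(\<lambda>x. g (F (int n) x) - orbit_sum r k n x) \<in> Lp_funs p M"
      using g(1) r by (intro Lp_funs_diff Lp_funs_F orbit_sum_Lp) auto
    from Lnorm_le_iff[OF this, of 1] g(2)[of n] show ?thesis
      by (simp add: orbit_sum_def bump_def s_def a_def)
  qed
  have "AE x in M. x \<in> cell l \<longrightarrow> g x = s" if "k < l" for l
    using eq_const_on_later_cells[OF unbounded Lp_funs_measurable[OF g(1)] bound that] .
  moreover have "pmass g \<le> 1"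
    using bound[of 0] by (simp add: F_0)
  ultimately have *: "ennreal (r powr p / a) * (\<Sum>j=1..n. emeasure M (cell (k + int j))) \<le> 1"
    using tail_le_of_eq_const[of g k s n] by (simp add: s)
  have "(\<Sum>j=1..n. emeasure M (cell (k + int j)))
      = ennreal (a / r powr p) * (ennreal (r powr p / a) * (\<Sum>j=1..n. emeasure M (cell (k + int j))))"
    using a r by (simp add: mult.assoc[symmetric] flip: ennreal_mult)
  also have "\<dots> \<le> ennreal (a / r powr p) * 1"
    using * by (rule mult_left_mono) simp
  also have "\<dots> = ennreal (1 / r powr p) * emeasure M (cell k)"
    using a by (simp flip: ennreal_mult)
  also have "\<dots> \<le> ennreal ?D * emeasure M (cell k)"
    by (intro mult_right_mono ennreal_leI) auto
  finally show "(\<Sum>j=1..n. emeasure M (cell (k + int j))) \<le> ennreal ?D * emeasure M (cell k)" .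
qed

lemma zero_Lp: "(\<lambda>x. 0) \<in> Lp_funs p M"
  using exponent by (simp add: Lp_funs_iff pmass_def)

text \<open>For the constant perturbation \<open>z = bump \<epsilon> k\<close>, evaluating the
  conjugacy at the fixed point \<open>0\<close> of \<open>T\<close> gives
  \<open>h 0 = T (h 0) + z\<close>, where \<open>h 0\<close> has norm at most
  \<open>1\<close>.\<close>

lemma bounded_orbits_if_structurally_stable:
  assumes stable: "strongly_structurally_stable (Lp p M) (comp_op p M f)"
  shows "\<exists>r>0. \<forall>k. \<exists>g\<in>Lp_funs p M. \<forall>n. Lnorm (\<lambda>x. g (F (int n) x) - orbit_sum r k n x) \<le> 1"
proof -
  interpret Metric_space "points (Lp p M)" "vdist (Lp p M)"
    by (rule Metric_space_Lp)
  obtain \<epsilon> where \<epsilon>: "0 < \<epsilon>" and conj: "\<And>\<phi>. \<phi> \<in> points (Lp p M) \<rightarrow> points (Lp p M) \<Longrightarrow>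
      \<forall>x\<in>points (Lp p M). vnorm (Lp p M) (\<phi> x) \<le> \<epsilon> \<Longrightarrow>
      \<forall>x\<in>points (Lp p M). \<forall>y\<in>points (Lp p M). vdist (Lp p M) (\<phi> x) (\<phi> y) \<le> \<epsilon> * vdist (Lp p M) x y \<Longrightarrow>
      \<exists>h. homeomorphic_map (vtopology (Lp p M)) (vtopology (Lp p M)) h \<and>
        (\<forall>x\<in>points (Lp p M). h (comp_op p M f x) = vadd (Lp p M) (comp_op p M f (h x)) (\<phi> (h x))) \<and>
        (\<forall>x\<in>points (Lp p M). vdist (Lp p M) (h x) x \<le> 1)"
    using stable[unfolded strongly_structurally_stable_def, rule_format, of 1] by auto
  have "\<exists>g\<in>Lp_funs p M. \<forall>n. Lnorm (\<lambda>x. g (F (int n) x) - orbit_sum \<epsilon> k n x) \<le> 1" for k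
  proof -
    let ?z = "bump \<epsilon> k" and ?O = "Lp_class p M (\<lambda>x. 0)"
    have z: "?z \<in> Lp_funs p M" "Lnorm ?z \<le> \<epsilon>"
      using bump_Lp \<epsilon> by simp_all
    \<comment> \<open>A constant map has Lipschitz constant \<open>0\<close>, so only the norm of
      the bump has to be below \<open>\<epsilon>\<close>.\<close>
    obtain h where h: "homeomorphic_map (vtopology (Lp p M)) (vtopology (Lp p M)) h"
      "\<And>x. x \<in> points (Lp p M) \<Longrightarrow>
        h (comp_op p M f x) = vadd (Lp p M) (comp_op p M f (h x)) (Lp_class p M ?z)"
      "\<And>x. x \<in> points (Lp p M) \<Longrightarrow> vdist (Lp p M) (h x) x \<le> 1"
      using conj[of "\<lambda>_. Lp_class p M ?z"] z \<epsilon> by (auto simp: Lp_class_in_points vnorm_Lp)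
    have O: "?O \<in> points (Lp p M)"
      by (intro Lp_class_in_points zero_Lp)
    have "h ` points (Lp p M) = points (Lp p M)"
      using homeomorphic_imp_surjective_map[OF h(1)] by (simp add: vtopology_def)
    then have "h ?O \<in> points (Lp p M)"
      using O by blast
    then obtain g where g: "g \<in> Lp_funs p M" "h ?O = Lp_class p M g"
      by (rule Lp_pointE)
    have gf: "(\<lambda>x. g (f x)) \<in> Lp_funs p M"
      using Lp_funs_F[OF g(1), of 1] by (simp add: F_1)
    have "Lp_class p M g = Lp_class p M (\<lambda>x. g (f x) + ?z x)"
      using h(2)[OF O] g z gf by (simp add: comp_op_f zero_Lp vadd_Lp)
    then have step: "AE x in M. g x = g (F 1 x) + ?z x"
      using Lp_class_eq_iff[OF g(1) Lp_funs_add[OF gf z(1)]] by (simp add: F_1)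
    have sum: "AE x in M. g x = g (F (int n) x) + orbit_sum \<epsilon> k n x" for n
    proof (induction n)
      case 0
      then show ?case by (simp add: F_0 orbit_sum_def)
    next
      case (Suc n)
      from Suc AE_F[OF step, of "int n"] AE_space show ?case
      proof eventually_elim
        case (elim x)
        then show ?case
          using F_add[of x 1 "int n"] by (simp add: orbit_sum_def algebra_simps)
      qed
    qed
    have "Lnorm g \<le> 1"
      using h(3)[OF O] by (simp add: g vdist_Lp zero_Lp)
    \<comment> \<open>The witness is \<open>- g\<close>: by \<open>sum\<close>, the difference
      between its \<open>n\<close>-th iterate and the orbit sum is \<open>- g\<close> again for
      every \<open>n\<close>.\<close>
    have "Lnorm (\<lambda>x. - g (F (int n) x) - orbit_sum \<epsilon> k n x) \<le> 1" for n
    proof -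
      have "Lnorm (\<lambda>x. - g (F (int n) x) - orbit_sum \<epsilon> k n x) = Lnorm (\<lambda>x. - 1 * g x)"
      proof (rule Lnorm_cong_AE)
        show "(\<lambda>x. - g (F (int n) x) - orbit_sum \<epsilon> k n x) \<in> Lp_funs p M"
          using Lp_funs_diff[OF Lp_funs_scale[OF Lp_funs_F[OF g(1)], of "- 1"] orbit_sum_Lp[of \<epsilon> k n]] \<epsilon>
          by simp
        show "AE x in M. - g (F (int n) x) - orbit_sum \<epsilon> k n x = - 1 * g x"
          using sum[of n] by eventually_elim simp
      qed (rule Lp_funs_scale[OF g(1)])
      also have "\<dots> = Lnorm g"
        by (simp add: Lnorm_def)
      finally show ?thesis
        using \<open>Lnorm g \<le> 1\<close> by simp
    qed
    then show ?thesis
      using Lp_funs_scale[OF g(1), of "- 1"] by (intro bexI[of _ "\<lambda>x. - g x"]) auto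
  qed
  then show ?thesis
    using \<epsilon> by blast
qed

text \<open>The orbit sums, continued by \<open>0\<close> to negative times, form a pseudo-orbit:
  the error is \<open>- bump \<delta> k\<close> at times \<open>n >= 0\<close> and \<open>0\<close>
  before.\<close>

lemma bounded_orbits_if_shadowing:
  assumes shadowing: "shadowing_property (Lp p M) (comp_op p M f)"
  shows "\<exists>r>0. \<forall>k. \<exists>g\<in>Lp_funs p M. \<forall>n. Lnorm (\<lambda>x. g (F (int n) x) - orbit_sum r k n x) \<le> 1"
proof -
  obtain \<delta> where \<delta>: "0 < \<delta>" and shadow: "\<And>x. \<forall>n. x n \<in> points (Lp p M) \<Longrightarrow>
      \<forall>n. vdist (Lp p M) (comp_op p M f (x n)) (x (n + 1)) \<le> \<delta> \<Longrightarrow>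
      \<exists>y\<in>points (Lp p M). \<forall>n. vdist (Lp p M) (ziter (points (Lp p M)) (comp_op p M f) n y) (x n) < 1"
    using shadowing[unfolded shadowing_property_def, rule_format, of 1] by auto
  have "\<exists>g\<in>Lp_funs p M. \<forall>n. Lnorm (\<lambda>x. g (F (int n) x) - orbit_sum \<delta> k n x) \<le> 1" for k
  proof -
    have z: "bump \<delta> k \<in> Lp_funs p M" "Lnorm (bump \<delta> k) \<le> \<delta>" and O: "\<And>n. orbit_sum \<delta> k n \<in> Lp_funs p M"
      using bump_Lp orbit_sum_Lp \<delta> by simp_all
    \<comment> \<open>For negative \<open>n\<close>, \<open>nat n = 0\<close> gives the empty sum.
      Since the sum is also empty at \<open>n = 0\<close>, there is no jump from time
      \<open>-1\<close> to time \<open>0\<close>.\<close>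
    define x where "x n = Lp_class p M (orbit_sum \<delta> k (nat n))" for n :: int
    have "vdist (Lp p M) (comp_op p M f (x n)) (x (n + 1)) \<le> \<delta>" for n
    proof -
      have OF: "(\<lambda>y. orbit_sum \<delta> k m (F 1 y)) \<in> Lp_funs p M" for m
        by (intro Lp_funs_F O)
      have dist: "vdist (Lp p M) (comp_op p M f (x n)) (x (n + 1))
          = Lnorm (\<lambda>y. orbit_sum \<delta> k (nat n) (F 1 y) - orbit_sum \<delta> k (nat (n + 1)) y)"
        unfolding x_def using O OF[of "nat n"] by (simp add: comp_op_f vdist_Lp F_1)
      show ?thesis
      proof (cases "0 \<le> n")
        case True
        then have n: "nat (n + 1) = Suc (nat n)"
          by simp
        have "Lnorm (\<lambda>y. orbit_sum \<delta> k (nat n) (F 1 y) - orbit_sum \<delta> k (nat (n + 1)) y)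
            = Lnorm (\<lambda>y. - 1 * bump \<delta> k y)"
        proof (rule Lnorm_cong_AE)
          show "AE y in M. orbit_sum \<delta> k (nat n) (F 1 y) - orbit_sum \<delta> k (nat (n + 1)) y = - 1 * bump \<delta> k y"
          proof (rule AE_I2)
            fix y assume y: "y \<in> space M"
            have "orbit_sum \<delta> k (nat n) (F 1 y) = (\<Sum>j<nat n. bump \<delta> k (F (int (Suc j)) y))"
            proof -
              have "F (int (Suc j)) y = F (int j) (F 1 y)" for j
                using F_add[OF y, of "int j" 1] by (simp add: add.commute)
              then show ?thesis
                by (simp only: orbit_sum_def)
            qed
            then show "orbit_sum \<delta> k (nat n) (F 1 y) - orbit_sum \<delta> k (nat (n + 1)) y = - 1 * bump \<delta> k y"
              unfolding n orbit_sum_def sum.lessThan_Suc_shift by (simp add: F_0)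
          qed
        qed (intro Lp_funs_diff O OF Lp_funs_scale z)+
        also have "\<dots> = Lnorm (bump \<delta> k)"
          by (simp add: Lnorm_def)
        finally show ?thesis
          using z dist by simp
      next
        case False
        then show ?thesis
          using \<delta> exponent unfolding dist by (simp add: orbit_sum_def Lnorm_def)
      qed
    qed
    then obtain y where y: "y \<in> points (Lp p M)"
      "\<And>n. vdist (Lp p M) (ziter (points (Lp p M)) (comp_op p M f) n y) (x n) < 1"
      using shadow[of x] O by (auto simp: x_def Lp_class_in_points)
    obtain g where g: "g \<in> Lp_funs p M" "y = Lp_class p M g"
      using y(1) by (rule Lp_pointE)
    have "Lnorm (\<lambda>x. g (F (int n) x) - orbit_sum \<delta> k n x) \<le> 1" for n
      using y(2)[of "int n"] g O
      by (simp add: ziter_def[of "points (Lp p M)"] comp_op_iter x_def vdist_Lp Lp_funs_F)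
    then show ?thesis
      using g(1) by blast
  qed
  then show ?thesis
    using \<delta> by blast
qed

end

theorem theoremC:
  fixes M :: "'a measure" and f :: "'a \<Rightarrow> 'a" and p :: real and W :: "'a set"
  assumes "dissipative_bounded_distortion_system M f p W"
    and "invertible_composition M f"
    and "(SUP n\<in>{1::nat..}. emeasure M (ziter (space M) f (- int n) ` W)) = \<infinity>"
  shows "strongly_structurally_stable (Lp p M) (comp_op p M f)
     \<longleftrightarrow> shadowing_property (Lp p M) (comp_op p M f)"
proof -
  interpret invertible_dissipative_system M f p W
    using assms(1,2) by (intro invertible_dissipative_system.intro invertible_dissipative_system_axioms.intro)
  have unbounded: "(SUP n\<in>{1::nat..}. emeasure M (cell (- int n))) = \<infinity>"
    using assms(3) by (simp add: cell_def)
  \<comment> \<open>Either property yields the bounded orbits and thereby expansion, which in turn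
    yields both properties.\<close>
  show ?thesis
    using expanding_operator.structurally_stable expanding_operator.shadowing
      expanding_if_bounded_orbits[OF unbounded]
      bounded_orbits_if_structurally_stable bounded_orbits_if_shadowing
    by metis
qed

end
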